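(* Let $f:\mathbb{R}\to\mathbb{R}$ be smooth and let $F=F(u)$ be a function such that $F'(u)=f(u)$. Consider the equation $$u_{tt}=u_{xx}+(\cot x)\,u_{x}+\frac{1}{\sin^{2}x}\,u_{yy}+f(u).$$ The conservation laws of the Noether symmetries of this equation, for any function $f(u)$, are: 1. For the symmetry $S_0=\frac{\partial}{\partial t}$, the conservation law is $Div(A)=0$, where $A=(A^0,A^1,A^2)$ and $$A^0=-\frac{\sin x}{2}u_t^2-\frac{\sin x}{2}u_x^2-\frac{1}{2\sin x}u_y^2-\sin x\,F(u),\quad A^1=\sin x\,u_tu_x,\quad A^2=\frac{1}{\sin x}u_tu_y.$$ 2. For the symmetry $S_1=\frac{\partial}{\partial y}$, the conservation law is $Div(B)=0$, where $B=(B^0,B^1,B^2)$ and $$B^0=-\sin x\,u_tu_y,\quad B^1=\sin x\,u_xu_y,\quad B^2=\frac{\sin x}{2}u_t^2-\frac{\sin x}{2}u_x^2+\frac{1}{2\sin x}u_y^2-\sin x\,F(u).$$ 3. For the symmetry $S_2=\sin y\frac{\partial}{\partial x}+\cot x\cos y\frac{\partial}{\partial y}$, the conservation law is $Div(C)=0$, where $C=(C^0,C^1,C^2)$ and $$C^0=-\sin x\sin y\,u_tu_x-\cos x\cos y\,u_tu_y,$$ $$C^1=\frac{\sin x\sin y}{2}u_t^2+\frac{\sin x\sin y}{2}u_x^2-\frac{\sin y}{2\sin x}u_y^2+\cos x\cos y\,u_xu_y-\sin x\sin y\,F(u),$$ $$C^2=\frac{\cos x\cos y}{2}u_t^2-\frac{\cos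 x\cos y}{2}u_x^2+\frac{\cos x\cos y}{2\sin^2x}u_y^2+\frac{\sin y}{\sin x}u_xu_y-\cos x\cos y\,F(u).$$ 4. For the symmetry $S_3=\cos y\frac{\partial}{\partial x}-\cot x\sin y\frac{\partial}{\partial y}$, the conservation law is $Div(D)=0$, where $D=(D^0,D^1,D^2)$ and $$D^0=-\sin x\cos y\,u_tu_x+\cos x\sin y\,u_tu_y,$$ $$D^1=\frac{\sin x\cos y}{2}u_t^2+\frac{\sin x\cos y}{2}u_x^2-\frac{\cos y}{2\sin x}u_y^2-\cos x\sin y\,u_xu_y-\sin x\cos y\,F(u),$$ $$D^2=-\frac{\cos x\sin y}{2}u_t^2+\frac{\cos x\sin y}{2}u_x^2-\frac{\cos x\sin y}{2\sin^2x}u_y^2+\frac{\cos y}{\sin x}u_xu_y+\cos x\sin y\,F(u).$$ 5. If $F(u)=c\,u^2/2$ with $c$ a constant, then the conservation law for the symmetry $S_\infty=b(x,y,t)\frac{\partial}{\partial u}$, with $b$ satisfying $b_{tt}=b_{xx}+(\cot x)\,b_x+\frac{1}{\sin^2x}b_{yy}+c\,b$, is $Div(\alpha)=0$, where $\alpha=(\alpha^0,\alpha^1,\alpha^2)$ and $$\alpha^0=\sin x\,(b\,u_t-b_t\,u),\quad \alpha^1=\sin x\,(b_x\,u-b\,u_x),\quad \alpha^2=\frac{1}{\sin x}(b_y\,u-b\,u_y).$$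
   Context: The independent variables are $x^0=t$, $x^1=x$, $x^2=y$, local coordinates on $\mathbb{S}^2\times\mathbb{R}$ with metric $ds^2=dt^2-dx^2-\sin^2x\,dy^2$, where $t\in\mathbb{R}$ and $(x,y)$ are spherical coordinates on $\mathbb{S}^2$ ($x\in(0,\pi)$ the polar angle, $y$ the azimuthal angle). For $V=(V^0,V^1,V^2)$ depending on $(t,x,y)$, $u$ and its derivatives, $Div(V)=D_tV^0+D_xV^1+D_yV^2$, where $D_t,D_x,D_y$ are total derivatives; a conservation law $Div(V)=0$ of the equation means that this identity holds for every solution $u$ of the equation. The Lagrangian used is $$\mathcal{L}=\frac{\sin x}{2}u_t^2-\frac{\sin x}{2}u_x^2-\frac{1}{2\sin x}u_y^2+\sin x\,F(u).$$ A vector field $X=\xi^i\,\partial/\partial x^i+\eta\,\partial/\partial u$ is a Noether symmetry if $X^{(1)}\mathcal{L}+\mathcal{L}\,D_i\xi^i=Div(V)$ for some $V$, where $X^{(1)}$ is the first prolongation of $X$ and repeated indices are summed.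
   Formalization: The sign of the F(u)-terms in A^0, B^2, C^1, C^2, D^1, D^2 is reversed: as printed, Div(A)=-2t sin x for f=1, F(u)=u, u=t^2/2. The corrected sign is that of Noether's theorem for the given Lagrangian. *)

theory Defs
  imports "HOL-Analysis.Analysis"
begin

text \<open>
  A base point is \<open>p = (t, x, y)\<close> with coordinates \<open>p $ 0\<close>, \<open>p $ 1\<close>, \<open>p $ 2\<close> (in the type \<open>3\<close>
  the numerals \<open>0, 1, 2\<close> are distinct and exhaust the type). A point of the fibre of the infinite
  jet space assigns to a multi-index \<open>J\<close> the value of the derivative \<open>u\<^sub>J\<close>; thus
  \<open>j 0 = u\<close>, \<open>j (E 0) = u\<^sub>t\<close>, \<open>j (E 0 + E 1) = u\<^sub>t\<^sub>x\<close>.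
\<close>

type_synonym point = "real^3"
type_synonym multi_index = "nat^3"
type_synonym jet = "multi_index \<Rightarrow> real"
type_synonym dfun = "point \<Rightarrow> jet \<Rightarrow> real"

definition E :: "3 \<Rightarrow> multi_index" where
  "E i = axis i 1"

definition triple :: "'a \<Rightarrow> 'a \<Rightarrow> 'a \<Rightarrow> 3 \<Rightarrow> 'a" where
  "triple a b c i = (if i = 0 then a else if i = 1 then b else c)"

definition strip :: "point set" where
  "strip = {p. 0 < p $ 1 \<and> p $ 1 < pi}"

subsection \<open>Functions on the base and their jets\<close>

definition partial :: "3 \<Rightarrow> (point \<Rightarrow> real) \<Rightarrow> point \<Rightarrow> real" where
  "partial i u p = deriv (\<lambda>s. u (p + s *\<^sub>R axis i 1)) 0"

definition smooth_on :: "point set \<Rightarrow> (point \<Rightarrow> real) \<Rightarrow> bool" where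
  "smooth_on U u \<longleftrightarrow> (\<forall>is. foldr partial is u differentiable_on U)"

definition smooth_real :: "(real \<Rightarrow> real) \<Rightarrow> bool" where
  "smooth_real f \<longleftrightarrow> (\<forall>n. (deriv ^^ n) f differentiable_on UNIV)"

definition jet_of :: "(point \<Rightarrow> real) \<Rightarrow> point \<Rightarrow> jet" where
  "jet_of u p J =
     (partial 0 ^^ (J $ 0)) ((partial 1 ^^ (J $ 1)) ((partial 2 ^^ (J $ 2)) u)) p"

subsection \<open>Differential functions and total derivatives\<close>

datatype coord = Base 3 | Fibre multi_index

fun along :: "coord \<Rightarrow> dfun \<Rightarrow> point \<Rightarrow> jet \<Rightarrow> real \<Rightarrow> real" where
  "along (Base i) P p j s = P (p + s *\<^sub>R axis i 1) j"
| "along (Fibre J) P p j s = P p (j(J := j J + s))"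

definition pd :: "coord \<Rightarrow> dfun \<Rightarrow> dfun" where
  "pd c P p j = deriv (along c P p j) 0"

definition multi_order :: "multi_index \<Rightarrow> nat" where
  "multi_order J = (\<Sum>i\<in>UNIV. J $ i)"

definition finite_order_on :: "point set \<Rightarrow> dfun \<Rightarrow> bool" where
  "finite_order_on U P \<longleftrightarrow>
     (\<exists>n. \<forall>p\<in>U. \<forall>j j'. (\<forall>J. multi_order J \<le> n \<longrightarrow> j J = j' J) \<longrightarrow> P p j = P p j')"

text \<open>
  Smooth functions of \<open>(t, x, y)\<close>, \<open>u\<close> and finitely many of its derivatives. Continuity refers to the
  product topology on jets; for a function of finite order this is joint continuity in \<open>(t, x, y)\<close>
  and the finitely many jet coordinates that occur.
\<close>

definition diff_fun_on :: "point set \<Rightarrow> dfun \<Rightarrow> bool" where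
  "diff_fun_on U P \<longleftrightarrow> finite_order_on U P \<and>
     (\<forall>cs. continuous_on (U \<times> UNIV) (\<lambda>(p, j). foldr pd cs P p j) \<and>
        (\<forall>c. \<forall>p\<in>U. \<forall>j. along c (foldr pd cs P) p j field_differentiable at 0))"

text \<open>
  \<open>D\<^sub>i P = \<partial>P/\<partial>x\<^sup>i + (\<Sum>J. u\<^bsub>J+i\<^esub> \<partial>P/\<partial>u\<^sub>J)\<close>; for a function of finite order only finitely many summands
  are non-zero.
\<close>

definition total_deriv :: "3 \<Rightarrow> dfun \<Rightarrow> dfun" where
  "total_deriv i P p j =
     pd (Base i) P p j + (\<Sum>J | pd (Fibre J) P p j \<noteq> 0. j (J + E i) * pd (Fibre J) P p j)"

definition Div :: "(3 \<Rightarrow> dfun) \<Rightarrow> dfun" where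
  "Div V p j = (\<Sum>i\<in>UNIV. total_deriv i (V i) p j)"

subsection \<open>Vector fields, first prolongation, Noether symmetries\<close>

text \<open>The pair \<open>(\<xi>, \<eta>)\<close> stands for \<open>\<xi>\<^sup>i(t,x,y,u) \<partial>/\<partial>x\<^sup>i + \<eta>(t,x,y,u) \<partial>/\<partial>u\<close>.\<close>

type_synonym vfield = "(3 \<Rightarrow> point \<Rightarrow> real \<Rightarrow> real) \<times> (point \<Rightarrow> real \<Rightarrow> real)"

definition xi :: "vfield \<Rightarrow> 3 \<Rightarrow> dfun" where
  "xi X i p j = fst X i p (j 0)"

definition eta :: "vfield \<Rightarrow> dfun" where
  "eta X p j = snd X p (j 0)"

definition eta1 :: "vfield \<Rightarrow> 3 \<Rightarrow> dfun" where
  "eta1 X i p j =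
     total_deriv i (eta X) p j - (\<Sum>k\<in>UNIV. j (E k) * total_deriv i (xi X k) p j)"

definition prolong1 :: "vfield \<Rightarrow> dfun \<Rightarrow> dfun" where
  "prolong1 X L p j =
     (\<Sum>i\<in>UNIV. xi X i p j * pd (Base i) L p j) + eta X p j * pd (Fibre 0) L p j
     + (\<Sum>i\<in>UNIV. eta1 X i p j * pd (Fibre (E i)) L p j)"

definition noether_symmetry_with :: "point set \<Rightarrow> dfun \<Rightarrow> vfield \<Rightarrow> (3 \<Rightarrow> dfun) \<Rightarrow> bool" where
  "noether_symmetry_with U L X V \<longleftrightarrow>
     (\<forall>i. diff_fun_on U (xi X i)) \<and> diff_fun_on U (eta X) \<and> (\<forall>i. diff_fun_on U (V i)) \<and>
     (\<forall>p\<in>U. \<forall>j. prolong1 X L p j + L p j * (\<Sum>i\<in>UNIV. total_deriv i (xi X i) p j) = Div V p j)"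

definition noether_symmetry :: "point set \<Rightarrow> dfun \<Rightarrow> vfield \<Rightarrow> bool" where
  "noether_symmetry U L X \<longleftrightarrow> (\<exists>V. noether_symmetry_with U L X V)"

text \<open>
  The conserved vector that Noether's theorem attaches to a symmetry \<open>X\<close> of a first-order Lagrangian
  with divergence term \<open>V\<close>.
\<close>

definition noether_current :: "dfun \<Rightarrow> vfield \<Rightarrow> (3 \<Rightarrow> dfun) \<Rightarrow> 3 \<Rightarrow> dfun" where
  "noether_current L X V i p j =
     xi X i p j * L p j
     + (eta X p j - (\<Sum>k\<in>UNIV. xi X k p j * j (E k))) * pd (Fibre (E i)) L p j - V i p j"

subsection \<open>The equation, its Lagrangian and its conservation laws\<close>

definition solution :: "(real \<Rightarrow> real) \<Rightarrow> point set \<Rightarrow> (point \<Rightarrow> real) \<Rightarrow> bool" where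
  "solution f U u \<longleftrightarrow> smooth_on U u \<and>
     (\<forall>p\<in>U. partial 0 (partial 0 u) p =
        partial 1 (partial 1 u) p + cot (p $ 1) * partial 1 u p
        + 1 / (sin (p $ 1))\<^sup>2 * partial 2 (partial 2 u) p + f (u p))"

definition lagrangian :: "(real \<Rightarrow> real) \<Rightarrow> dfun" where
  "lagrangian F p j =
     sin (p $ 1) / 2 * (j (E 0))\<^sup>2 - sin (p $ 1) / 2 * (j (E 1))\<^sup>2
     - 1 / (2 * sin (p $ 1)) * (j (E 2))\<^sup>2 + sin (p $ 1) * F (j 0)"

definition conservation_law :: "(real \<Rightarrow> real) \<Rightarrow> point set \<Rightarrow> (3 \<Rightarrow> dfun) \<Rightarrow> bool" where
  "conservation_law f U A \<longleftrightarrow> (\<forall>i. diff_fun_on U (A i)) \<and>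
     (\<forall>u. solution f U u \<longrightarrow> (\<forall>p\<in>U. Div A p (jet_of u p) = 0))"

definition noether_conservation_law ::
  "(real \<Rightarrow> real) \<Rightarrow> point set \<Rightarrow> dfun \<Rightarrow> vfield \<Rightarrow> (3 \<Rightarrow> dfun) \<Rightarrow> bool" where
  "noether_conservation_law f U L X A \<longleftrightarrow>
     (\<exists>V. noether_symmetry_with U L X V \<and>
        (\<forall>i. \<forall>p\<in>U. \<forall>j. A i p j = noether_current L X V i p j)) \<and>
     conservation_law f U A"

subsection \<open>The symmetries\<close>

definition S0 :: vfield where
  "S0 = (triple (\<lambda>p v. 1) (\<lambda>p v. 0) (\<lambda>p v. 0), \<lambda>p v. 0)"

definition S1 :: vfield where
  "S1 = (triple (\<lambda>p v. 0) (\<lambda>p v. 0) (\<lambda>p v. 1), \<lambda>p v. 0)"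

definition S2 :: vfield where
  "S2 = (triple (\<lambda>p v. 0) (\<lambda>p v. sin (p $ 2)) (\<lambda>p v. cot (p $ 1) * cos (p $ 2)), \<lambda>p v. 0)"

definition S3 :: vfield where
  "S3 = (triple (\<lambda>p v. 0) (\<lambda>p v. cos (p $ 2)) (\<lambda>p v. - (cot (p $ 1) * sin (p $ 2))), \<lambda>p v. 0)"

definition S_inf :: "(point \<Rightarrow> real) \<Rightarrow> vfield" where
  "S_inf b = (triple (\<lambda>p v. 0) (\<lambda>p v. 0) (\<lambda>p v. 0), \<lambda>p v. b p)"

subsection \<open>The conserved vectors\<close>

text \<open>
  The terms with \<open>F\<close> carry the sign that they have in \<open>\<xi>\<^sup>i L\<close> for the Lagrangian with \<open>+ sin x F(u)\<close> and
  \<open>F' = f\<close>. With the opposite sign in these terms of \<open>A, B, C, D\<close> the divergence is not zero on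
  solutions: for \<open>f = 1\<close>, \<open>F(u) = u\<close>, \<open>u = t\<^sup>2/2\<close> that of \<open>A\<close> would be \<open>- 2 t sin x\<close>.
\<close>

definition current_A :: "(real \<Rightarrow> real) \<Rightarrow> 3 \<Rightarrow> dfun" where
  "current_A F = triple
     (\<lambda>p j. - (sin (p $ 1) / 2 * (j (E 0))\<^sup>2) - sin (p $ 1) / 2 * (j (E 1))\<^sup>2
        - 1 / (2 * sin (p $ 1)) * (j (E 2))\<^sup>2 + sin (p $ 1) * F (j 0))
     (\<lambda>p j. sin (p $ 1) * j (E 0) * j (E 1))
     (\<lambda>p j. 1 / sin (p $ 1) * j (E 0) * j (E 2))"

definition current_B :: "(real \<Rightarrow> real) \<Rightarrow> 3 \<Rightarrow> dfun" where
  "current_B F = triple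
     (\<lambda>p j. - (sin (p $ 1) * j (E 0) * j (E 2)))
     (\<lambda>p j. sin (p $ 1) * j (E 1) * j (E 2))
     (\<lambda>p j. sin (p $ 1) / 2 * (j (E 0))\<^sup>2 - sin (p $ 1) / 2 * (j (E 1))\<^sup>2
        + 1 / (2 * sin (p $ 1)) * (j (E 2))\<^sup>2 + sin (p $ 1) * F (j 0))"

definition current_C :: "(real \<Rightarrow> real) \<Rightarrow> 3 \<Rightarrow> dfun" where
  "current_C F = triple
     (\<lambda>p j. - (sin (p $ 1) * sin (p $ 2) * j (E 0) * j (E 1))
        - cos (p $ 1) * cos (p $ 2) * j (E 0) * j (E 2))
     (\<lambda>p j. sin (p $ 1) * sin (p $ 2) / 2 * (j (E 0))\<^sup>2
        + sin (p $ 1) * sin (p $ 2) / 2 * (j (E 1))\<^sup>2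
        - sin (p $ 2) / (2 * sin (p $ 1)) * (j (E 2))\<^sup>2
        + cos (p $ 1) * cos (p $ 2) * j (E 1) * j (E 2)
        + sin (p $ 1) * sin (p $ 2) * F (j 0))
     (\<lambda>p j. cos (p $ 1) * cos (p $ 2) / 2 * (j (E 0))\<^sup>2
        - cos (p $ 1) * cos (p $ 2) / 2 * (j (E 1))\<^sup>2
        + cos (p $ 1) * cos (p $ 2) / (2 * (sin (p $ 1))\<^sup>2) * (j (E 2))\<^sup>2
        + sin (p $ 2) / sin (p $ 1) * j (E 1) * j (E 2)
        + cos (p $ 1) * cos (p $ 2) * F (j 0))"

definition current_D :: "(real \<Rightarrow> real) \<Rightarrow> 3 \<Rightarrow> dfun" where
  "current_D F = triple
     (\<lambda>p j. - (sin (p $ 1) * cos (p $ 2) * j (E 0) * j (E 1))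
        + cos (p $ 1) * sin (p $ 2) * j (E 0) * j (E 2))
     (\<lambda>p j. sin (p $ 1) * cos (p $ 2) / 2 * (j (E 0))\<^sup>2
        + sin (p $ 1) * cos (p $ 2) / 2 * (j (E 1))\<^sup>2
        - cos (p $ 2) / (2 * sin (p $ 1)) * (j (E 2))\<^sup>2
        - cos (p $ 1) * sin (p $ 2) * j (E 1) * j (E 2)
        + sin (p $ 1) * cos (p $ 2) * F (j 0))
     (\<lambda>p j. - (cos (p $ 1) * sin (p $ 2) / 2 * (j (E 0))\<^sup>2)
        + cos (p $ 1) * sin (p $ 2) / 2 * (j (E 1))\<^sup>2
        - cos (p $ 1) * sin (p $ 2) / (2 * (sin (p $ 1))\<^sup>2) * (j (E 2))\<^sup>2
        + cos (p $ 2) / sin (p $ 1) * j (E 1) * j (E 2)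
        - cos (p $ 1) * sin (p $ 2) * F (j 0))"

definition current_alpha :: "(point \<Rightarrow> real) \<Rightarrow> 3 \<Rightarrow> dfun" where
  "current_alpha b = triple
     (\<lambda>p j. sin (p $ 1) * (b p * j (E 0) - partial 0 b p * j 0))
     (\<lambda>p j. sin (p $ 1) * (partial 1 b p * j 0 - b p * j (E 1)))
     (\<lambda>p j. 1 / sin (p $ 1) * (partial 2 b p * j 0 - b p * j (E 2)))"

end

theory Submission
  imports Defs
begin

text \<open>
  The conservation laws are instances of Noether's theorem.
  The Euler-Lagrange expression \<open>\<delta>L/\<delta>u\<close> of the Lagrangian is \<open>sin x\<close> times the difference of the two sides of
  the equation.
  For every symmetry \<open>X = \<xi>\<^sup>i \<partial>/\<partial>x\<^sup>i + \<eta> \<partial>/\<partial>u\<close> with divergence term \<open>V\<close> the Noether current \<open>N\<close> satisfies, as an identity on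
  jets, \<open>Div N = (\<xi>\<^sup>k u\<^sub>k - \<eta>) (\<delta>L/\<delta>u)\<close> (lemma \<open>Div_noether_current\<close>), and the right-hand side vanishes
  on the jet of a solution (\<open>euler_lagrange_solution\<close>). What then remains for each symmetry is to name
  \<open>V\<close>, to verify the symmetry condition, and to recognise the given vector as the current
  (\<open>noether_conservation_lawI\<close>).

  The Lagrangian depends neither on \<open>t\<close> nor on \<open>y\<close>, so \<open>S\<^sub>0\<close> and \<open>S\<^sub>1\<close> are symmetries with \<open>V = 0\<close>. The fields
  \<open>S\<^sub>2\<close> and \<open>S\<^sub>3\<close> are rotations of the sphere about two horizontal axes. Both have the form
  \<open>g(y) \<partial>/\<partial>x + cot x g'(y) \<partial>/\<partial>y\<close> with \<open>g'' = - g\<close>, and this alone makes them symmetries with \<open>V = 0\<close>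
  (\<open>rotation_symmetry\<close>). For a quadratic \<open>F\<close> the equation is linear, and adding a
  small multiple of a solution \<open>b\<close> to \<open>u\<close> changes the Lagrangian to first order by \<open>b\<^sub>i \<partial>L/\<partial>u\<^sub>i + b \<partial>L/\<partial>u\<close>, which by the equation for \<open>b\<close>
  is the divergence of \<open>V = (sin x b\<^sub>t u, - sin x b\<^sub>x u, - b\<^sub>y u / sin x)\<close>.

  The analytic side consists of two facts. Smooth differential functions are closed under sums,
  products, reciprocals of functions without zeros, and composition with smooth functions (\<open>elementary_imp_diff_fun_on\<close>), and on
  them the total derivatives are derivations (\<open>total_deriv_add\<close>, \<open>total_deriv_mult\<close>).
\<close>

section \<open>Coordinates\<close>

lemma UNIV_three: "(UNIV :: 3 set) = {0, 1, 2}"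
  using UNIV_3 by auto

lemma sum_UNIV_three: "(\<Sum>i\<in>UNIV. g (i::3)) = g 0 + g 1 + g 2" for g :: "3 \<Rightarrow> 'a::comm_monoid_add"
  unfolding UNIV_three by (simp add: add.assoc)

lemma forall_three: "(\<forall>i::3. P i) \<longleftrightarrow> P 0 \<and> P 1 \<and> P 2"
  by (metis UNIV_I UNIV_three empty_iff insert_iff)

lemma three_cases: "i = 0 \<or> i = 1 \<or> i = 2" for i :: 3
  using UNIV_I[of i] unfolding UNIV_three by simp

lemma E_nth: "E i $ k = (if k = i then 1 else 0)"
  by (simp add: E_def axis_def)

lemma E_neq_0 [simp]: "E i \<noteq> 0" "0 \<noteq> E i"
  by (auto simp: vec_eq_iff E_nth)

lemma E_inject [simp]: "E i = E k \<longleftrightarrow> i = k"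
  by (metis E_nth zero_neq_one)

lemma multi_order_le_1: "multi_order J \<le> 1 \<longleftrightarrow> J = 0 \<or> (\<exists>k. J = E k)"
proof
  assume "multi_order J \<le> 1"
  then have "J $ 0 + J $ 1 + J $ 2 \<le> 1"
    by (simp add: multi_order_def sum_UNIV_three)
  then consider "J $ 0 = 0" "J $ 1 = 0" "J $ 2 = 0" | "J $ 0 = 1" "J $ 1 = 0" "J $ 2 = 0"
    | "J $ 0 = 0" "J $ 1 = 1" "J $ 2 = 0" | "J $ 0 = 0" "J $ 1 = 0" "J $ 2 = 1"
    by linarith
  then have "J = 0 \<or> J = E 0 \<or> J = E 1 \<or> J = E 2"
    by cases (simp_all add: vec_eq_iff forall_three E_nth)
  then show "J = 0 \<or> (\<exists>k. J = E k)" by blast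
qed (auto simp: multi_order_def E_nth)

lemma finite_multi_order_le: "finite {J. multi_order J \<le> n}"
proof (rule inj_on_finite)
  show "inj_on (\<lambda>J::multi_index. (J $ 0, J $ 1, J $ 2)) {J. multi_order J \<le> n}"
    by (auto simp: inj_on_def vec_eq_iff forall_three)
  show "(\<lambda>J::multi_index. (J $ 0, J $ 1, J $ 2)) ` {J. multi_order J \<le> n} \<subseteq> {..n} \<times> {..n} \<times> {..n}"
    by (auto simp: multi_order_def sum_UNIV_three)
qed simp

section \<open>Differentiating along a coordinate\<close>

lemma along_0 [simp]: "along c P p j 0 = P p j"
  by (cases c) auto

lemma along_Base: "along (Base i) P p j = (\<lambda>s. P (p + s *\<^sub>R axis i 1) j)"
  and along_Fibre: "along (Fibre J) P p j = (\<lambda>s. P p (j(J := j J + s)))"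
  by (simp_all add: fun_eq_iff)

lemma along_add [simp]: "along c (\<lambda>p j. P p j + Q p j) p j s = along c P p j s + along c Q p j s"
  by (cases c) auto

lemma along_mult [simp]: "along c (\<lambda>p j. P p j * Q p j) p j s = along c P p j s * along c Q p j s"
  by (cases c) auto

lemma along_compose: "along c (\<lambda>p j. h (P p j)) p j s = h (along c P p j s)"
  by (cases c) auto

text \<open>
  All derivatives at a point of an open set are local. In a base direction the point itself moves,
  but it stays in the set for small parameters.
\<close>

lemma along_cong:
  assumes "open U" "p \<in> U" "\<And>p j. p \<in> U \<Longrightarrow> P p j = Q p j"
  shows "\<forall>\<^sub>F s in nhds 0. along c P p j s = along c Q p j s"
proof (cases c)
  case (Base i)
  have "((\<lambda>s. p + s *\<^sub>R axis i 1) \<longlongrightarrow> p + 0 *\<^sub>R axis i 1) (nhds 0)"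
    by (intro tendsto_intros filterlim_ident)
  then have "\<forall>\<^sub>F s in nhds 0. p + s *\<^sub>R axis i 1 \<in> U"
    using assms(1,2) by (auto dest: topological_tendstoD)
  then show ?thesis
    by eventually_elim (simp add: Base assms(3))
qed (simp add: assms)

lemma pd_cong:
  assumes "open U" "p \<in> U" "\<And>p j. p \<in> U \<Longrightarrow> P p j = Q p j"
  shows "pd c P p j = pd c Q p j"
  unfolding pd_def by (rule deriv_cong_ev[OF along_cong[OF assms] refl])

lemma foldr_pd_cong:
  assumes "open U" "p \<in> U" "\<And>p j. p \<in> U \<Longrightarrow> P p j = Q p j"
  shows "foldr pd cs P p j = foldr pd cs Q p j"
  using assms(2)
proof (induction cs arbitrary: p j)
  case (Cons c cs)
  then show ?case
    using pd_cong[OF assms(1), of p "foldr pd cs P" "foldr pd cs Q"] by simp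
qed (use assms in auto)

lemma finite_order_on_cong:
  assumes "\<And>p j. p \<in> U \<Longrightarrow> P p j = Q p j" "finite_order_on U P"
  shows "finite_order_on U Q"
  using assms unfolding finite_order_on_def by metis

text \<open>
  Differentiation does not raise the order: changing jet coordinates above the order of \<open>P\<close> changes
  none of the functions whose derivative is taken. In a base direction this agreement holds only at
  points of the open set, hence the appeal to locality.
\<close>

lemma finite_order_on_pd:
  assumes "open U" "finite_order_on U P"
  shows "finite_order_on U (pd c P)"
proof -
  obtain n where n: "\<And>p j j'. p \<in> U \<Longrightarrow> (\<forall>J. multi_order J \<le> n \<longrightarrow> j J = j' J) \<Longrightarrow> P p j = P p j'"
    using assms(2) unfolding finite_order_on_def by metis
  have "pd c P p j = pd c P p j'" if p: "p \<in> U" and eq: "\<forall>J. multi_order J \<le> n \<longrightarrow> j J = j' J" for p j j'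
  proof (cases c)
    case (Base i)
    have "pd (Base i) (\<lambda>p _. P p j) p j = pd (Base i) (\<lambda>p _. P p j') p j"
      by (rule pd_cong[OF assms(1) p]) (use n eq in blast)
    moreover have "along (Base i) (\<lambda>p _. P p k) p j0 = along (Base i) P p k" for k j0
      by auto
    ultimately show ?thesis by (simp add: Base pd_def)
  next
    case (Fibre K)
    have "P p (j(K := j K + s)) = P p (j'(K := j' K + s))" for s
      by (rule n[OF p]) (use eq in auto)
    then have "along (Fibre K) P p j = along (Fibre K) P p j'" by (simp add: fun_eq_iff)
    then show ?thesis by (simp add: Fibre pd_def)
  qed
  then show ?thesis unfolding finite_order_on_def by blast
qed

section \<open>The algebra of differential functions\<close>

lemma diff_fun_on_finite_order: "diff_fun_on U P \<Longrightarrow> finite_order_on U P"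
  by (simp add: diff_fun_on_def)

lemma diff_fun_on_continuous: "diff_fun_on U P \<Longrightarrow> continuous_on (U \<times> UNIV) (\<lambda>(p, j). P p j)"
  unfolding diff_fun_on_def by (metis foldr_Nil id_apply)

lemma diff_fun_on_has_derivative:
  assumes "diff_fun_on U P" "p \<in> U"
  shows "(along c P p j has_real_derivative pd c P p j) (at 0)"
  using assms unfolding diff_fun_on_def pd_def DERIV_deriv_iff_field_differentiable
  by (metis foldr_Nil id_apply)

lemma diff_fun_on_pd:
  assumes "open U" "diff_fun_on U P"
  shows "diff_fun_on U (pd c P)"
proof -
  have "foldr pd cs (pd c P) = foldr pd (cs @ [c]) P" for cs by simp
  then show ?thesis
    using assms finite_order_on_pd unfolding diff_fun_on_def by metis
qed

lemma diff_fun_on_cong: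
  assumes "open U" "\<And>p j. p \<in> U \<Longrightarrow> P p j = Q p j" "diff_fun_on U P"
  shows "diff_fun_on U Q"
proof -
  have fo: "finite_order_on U Q"
    using finite_order_on_cong assms diff_fun_on_finite_order by metis
  have eq: "foldr pd cs P p j = foldr pd cs Q p j" if "p \<in> U" for cs p j
    using foldr_pd_cong[OF assms(1) that, of P Q] assms(2) by blast
  have cont: "continuous_on (U \<times> UNIV) (\<lambda>(p, j). foldr pd cs Q p j)" for cs
  proof -
    have "continuous_on (U \<times> UNIV) (\<lambda>(p, j). foldr pd cs P p j)"
      using assms(3) by (simp add: diff_fun_on_def)
    then show ?thesis
      by (rule continuous_on_eq) (auto simp: eq)
  qed
  have "along c (foldr pd cs Q) p j field_differentiable at 0" if p: "p \<in> U" for cs c p j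
  proof -
    have "\<forall>\<^sub>F s in nhds 0. along c (foldr pd cs P) p j s = along c (foldr pd cs Q) p j s"
      by (rule along_cong[OF assms(1) p eq])
    moreover have "along c (foldr pd cs P) p j field_differentiable at 0"
      using assms(3) p by (simp add: diff_fun_on_def)
    ultimately show ?thesis
      unfolding field_differentiable_def using DERIV_cong_ev by blast
  qed
  then show ?thesis
    unfolding diff_fun_on_def using fo cont by blast
qed

text \<open>
  Smoothness quantifies over all iterated partial derivatives, so closure properties cannot be proved
  by a direct induction: the derivative of a product is a sum of products. The remedy is
  coinductive: any class \<open>C\<close> of continuous functions that is stable under partial derivatives
  consists of smooth ones. The derivatives need to agree with members of \<open>C\<close> only on \<open>U\<close>, which leaves room for
  functions with singularities elsewhere.
\<close>

lemma diff_fun_on_coinduct: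
  assumes "open U" "C P"
    and fo: "finite_order_on U P"
    and cont: "\<And>P. C P \<Longrightarrow> continuous_on (U \<times> UNIV) (\<lambda>(p, j). P p j)"
    and step: "\<And>P c. C P \<Longrightarrow> \<exists>Q. C Q \<and> (\<forall>p\<in>U. \<forall>j. (along c P p j has_real_derivative Q p j) (at 0))"
  shows "diff_fun_on U P"
proof -
  have ex: "\<exists>Q. C Q \<and> (\<forall>p\<in>U. \<forall>j. foldr pd cs P p j = Q p j)" for cs
  proof (induction cs)
    case (Cons c cs)
    then obtain Q where Q: "C Q" "\<forall>p\<in>U. \<forall>j. foldr pd cs P p j = Q p j" by blast
    obtain R where R: "C R" "\<forall>p\<in>U. \<forall>j. (along c Q p j has_real_derivative R p j) (at 0)"
      using step[OF Q(1)] by blast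
    have "pd c (foldr pd cs P) p j = R p j" if p: "p \<in> U" for p j
    proof -
      have "pd c (foldr pd cs P) p j = pd c Q p j"
        by (rule pd_cong[OF assms(1) p]) (use Q(2) in blast)
      also have "\<dots> = R p j"
        unfolding pd_def using R(2) p by (blast intro: DERIV_imp_deriv)
      finally show ?thesis .
    qed
    then show ?case using R(1) by auto
  qed (use assms in auto)
  have "continuous_on (U \<times> UNIV) (\<lambda>(p, j). foldr pd cs P p j)" for cs
  proof -
    obtain Q where Q: "C Q" "\<forall>p\<in>U. \<forall>j. foldr pd cs P p j = Q p j" using ex by blast
    show ?thesis
      by (rule continuous_on_eq[OF cont[OF Q(1)]]) (auto simp: Q(2))
  qed
  moreover have "along c (foldr pd cs P) p j field_differentiable at 0" if p: "p \<in> U" for cs c p j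
  proof -
    obtain Q where Q: "C Q" "\<forall>p\<in>U. \<forall>j. foldr pd cs P p j = Q p j" using ex by blast
    have "\<forall>\<^sub>F s in nhds 0. along c (foldr pd cs P) p j s = along c Q p j s"
      using along_cong[OF assms(1) p] Q(2) by blast
    moreover have "along c Q p j field_differentiable at 0"
      using step[OF Q(1)] p unfolding field_differentiable_def by blast
    ultimately show ?thesis
      unfolding field_differentiable_def using DERIV_cong_ev by blast
  qed
  ultimately show ?thesis unfolding diff_fun_on_def using fo by blast
qed

lemma smooth_real_deriv: "smooth_real h \<Longrightarrow> smooth_real (deriv h)"
  unfolding smooth_real_def by (metis comp_apply funpow_Suc_right)

lemma smooth_real_has_derivative: "smooth_real h \<Longrightarrow> (h has_real_derivative deriv h x) (at x)"
  unfolding smooth_real_def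
  by (metis DERIV_deriv_iff_real_differentiable UNIV_I differentiable_on_def funpow_0)

lemma DERIV_imp_differentiable_on:
  assumes "\<And>x. (h has_real_derivative h' x) (at x)"
  shows "h differentiable_on UNIV"
  using assms unfolding differentiable_on_def real_differentiable_def by blast

lemma smooth_real_affine: "smooth_real (\<lambda>x. a * x + b)"
proof -
  have "(deriv ^^ n) (\<lambda>x::real. a * x + b) differentiable_on UNIV" for n
  proof (induction n arbitrary: a b)
    case (Suc n)
    have "deriv (\<lambda>x::real. a * x + b) = (\<lambda>x. 0 * x + a)"
      by (intro ext DERIV_imp_deriv) (auto intro!: derivative_eq_intros)
    then show ?case using Suc.IH[of 0 a] by (simp only: funpow_Suc_right comp_apply)
  qed (auto intro!: derivative_intros)
  then show ?thesis by (simp add: smooth_real_def)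
qed

lemma smooth_real_uminus: "smooth_real uminus"
  using smooth_real_affine[of "-1" 0] by simp

text \<open>
  The span of \<open>sin\<close> and \<open>cos\<close> is stable under differentiation, which the induction needs.
\<close>

lemma smooth_real_trig: "smooth_real (\<lambda>x. a * sin x + b * cos x)"
proof -
  have "(deriv ^^ n) (\<lambda>x::real. a * sin x + b * cos x) differentiable_on UNIV" for n
  proof (induction n arbitrary: a b)
    case 0
    show ?case
      by (simp, rule DERIV_imp_differentiable_on) (rule derivative_eq_intros refl)+
  next
    case (Suc n)
    have "deriv (\<lambda>x::real. a * sin x + b * cos x) = (\<lambda>x. (- b) * sin x + a * cos x)"
      by (intro ext DERIV_imp_deriv) (auto intro!: derivative_eq_intros)
    then show ?case using Suc.IH[of "- b" a] by (simp only: funpow_Suc_right comp_apply)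
  qed
  then show ?thesis by (simp add: smooth_real_def)
qed

lemma smooth_real_sin: "smooth_real sin"
  using smooth_real_trig[of 1 0] by simp

lemma smooth_real_cos: "smooth_real cos"
  using smooth_real_trig[of 0 1] by simp

lemma smooth_real_antiderivative:
  assumes "smooth_real f" "\<And>v. (F has_real_derivative f v) (at v)"
  shows "smooth_real F"
proof -
  have "deriv F = f" using assms(2) DERIV_imp_deriv by blast
  then have "(deriv ^^ Suc n) F = (deriv ^^ n) f" for n
    by (simp only: funpow_Suc_right comp_apply)
  moreover have "F differentiable_on UNIV"
    using assms(2) by (rule DERIV_imp_differentiable_on)
  ultimately have "(deriv ^^ n) F differentiable_on UNIV" for n
    using assms(1) unfolding smooth_real_def by (cases n) simp_all
  then show ?thesis by (simp add: smooth_real_def)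
qed

text \<open>
  The smallest class that contains the smooth differential functions and all the operations at once.
  It is stable under partial derivatives, by the sum, product, reciprocal and chain rules, and so is
  suitable for coinduction; the class of products of two smooth functions would not be.
\<close>

inductive elementary :: "point set \<Rightarrow> dfun \<Rightarrow> bool" for U where
  diff_fun: "diff_fun_on U P \<Longrightarrow> elementary U P"
| add: "elementary U P \<Longrightarrow> elementary U Q \<Longrightarrow> elementary U (\<lambda>p j. P p j + Q p j)"
| mult: "elementary U P \<Longrightarrow> elementary U Q \<Longrightarrow> elementary U (\<lambda>p j. P p j * Q p j)"
| inverse: "elementary U P \<Longrightarrow> (\<And>p j. p \<in> U \<Longrightarrow> P p j \<noteq> 0) \<Longrightarrow> elementary U (\<lambda>p j. inverse (P p j))"
| compose: "elementary U P \<Longrightarrow> smooth_real h \<Longrightarrow> elementary U (\<lambda>p j. h (P p j))"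

lemma finite_order_on_compose:
  assumes "finite_order_on U P"
  shows "finite_order_on U (\<lambda>p j. h (P p j))"
  using assms unfolding finite_order_on_def by metis

lemma finite_order_on_compose2:
  assumes "finite_order_on U P" "finite_order_on U Q"
  shows "finite_order_on U (\<lambda>p j. h (P p j) (Q p j))"
proof -
  obtain n m where
    "\<forall>p\<in>U. \<forall>j j'. (\<forall>J. multi_order J \<le> n \<longrightarrow> j J = j' J) \<longrightarrow> P p j = P p j'"
    "\<forall>p\<in>U. \<forall>j j'. (\<forall>J. multi_order J \<le> m \<longrightarrow> j J = j' J) \<longrightarrow> Q p j = Q p j'"
    using assms unfolding finite_order_on_def by auto
  then have "\<forall>p\<in>U. \<forall>j j'. (\<forall>J. multi_order J \<le> max n m \<longrightarrow> j J = j' J) \<longrightarrow> h (P p j) (Q p j) = h (P p j') (Q p j')"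
    by (metis max.coboundedI1 max.coboundedI2)
  then show ?thesis unfolding finite_order_on_def by blast
qed

lemma elementary_finite_order: "elementary U P \<Longrightarrow> finite_order_on U P"
proof (induction rule: elementary.induct)
  case (diff_fun P)
  then show ?case by (rule diff_fun_on_finite_order)
next
  case (add P Q)
  show ?case by (rule finite_order_on_compose2[OF add.IH])
next
  case (mult P Q)
  show ?case by (rule finite_order_on_compose2[OF mult.IH])
next
  case (inverse P)
  show ?case by (rule finite_order_on_compose[OF inverse.IH])
next
  case (compose P h)
  show ?case by (rule finite_order_on_compose[OF compose.IH])
qed

lemma elementary_continuous: "elementary U P \<Longrightarrow> continuous_on (U \<times> UNIV) (\<lambda>(p, j). P p j)"
proof (induction rule: elementary.induct)
  case (compose P h)
  have "continuous_on UNIV h"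
    using compose(2) smooth_real_has_derivative DERIV_continuous_on by blast
  from continuous_on_compose2[OF this compose(3)] show ?case
    by (simp add: case_prod_unfold)
qed (auto simp: case_prod_unfold intro!: continuous_intros dest: diff_fun_on_continuous)

lemma elementary_has_derivative:
  assumes "open U"
  shows "elementary U P \<Longrightarrow>
    \<exists>Q. elementary U Q \<and> (\<forall>p\<in>U. \<forall>j. (along c P p j has_real_derivative Q p j) (at 0))"
proof (induction rule: elementary.induct)
  case (diff_fun P)
  then show ?case
    using diff_fun_on_has_derivative diff_fun_on_pd[OF assms] elementary.diff_fun by blast
next
  case (add P Q)
  then obtain P' Q' where "elementary U P'" "elementary U Q'"
    and "\<forall>p\<in>U. \<forall>j. (along c P p j has_real_derivative P' p j) (at 0)"
    and "\<forall>p\<in>U. \<forall>j. (along c Q p j has_real_derivative Q' p j) (at 0)" by blast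
  then show ?case
    by (intro exI[of _ "\<lambda>p j. P' p j + Q' p j"])
      (auto intro: elementary.add intro!: DERIV_add simp: along_add[abs_def])
next
  case (mult P Q)
  then obtain P' Q' where el: "elementary U P'" "elementary U Q'"
    and D: "\<forall>p\<in>U. \<forall>j. (along c P p j has_real_derivative P' p j) (at 0)"
      "\<forall>p\<in>U. \<forall>j. (along c Q p j has_real_derivative Q' p j) (at 0)" by blast
  have "elementary U (\<lambda>p j. P' p j * Q p j + Q' p j * P p j)"
    using el mult.hyps by (intro elementary.add elementary.mult)
  moreover have "(along c (\<lambda>p j. P p j * Q p j) p j has_real_derivative
      P' p j * Q p j + Q' p j * P p j) (at 0)" if "p \<in> U" for p j
    using DERIV_mult[OF D(1)[rule_format, OF that, of j] D(2)[rule_format, OF that, of j]]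
    by (simp add: along_mult[abs_def])
  ultimately show ?case by blast
next
  case (inverse P)
  then obtain P' where el: "elementary U P'"
    and P': "\<forall>p\<in>U. \<forall>j. (along c P p j has_real_derivative P' p j) (at 0)" by blast
  from el have "elementary U (\<lambda>p j. - (P' p j * (inverse (P p j) * inverse (P p j))))"
    using inverse.hyps smooth_real_uminus
    by (intro elementary.compose[where h = uminus] elementary.mult elementary.inverse) auto
  moreover have "(along c (\<lambda>p j. inverse (P p j)) p j has_real_derivative
      - (P' p j * (inverse (P p j) * inverse (P p j)))) (at 0)" if "p \<in> U" for p j
    unfolding along_compose[abs_def] using P' inverse.hyps that
    by (auto intro!: derivative_eq_intros simp: power2_eq_square)
  ultimately show ?case by blast
next
  case (compose P h)
  then obtain P' where P': "elementary U P'"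
    "\<forall>p\<in>U. \<forall>j. (along c P p j has_real_derivative P' p j) (at 0)" by blast
  have "elementary U (\<lambda>p j. deriv h (P p j) * P' p j)"
    by (rule elementary.mult[OF elementary.compose[OF compose.hyps(1) smooth_real_deriv] P'(1)])
      (rule compose.hyps)
  moreover have "(along c (\<lambda>p j. h (P p j)) p j has_real_derivative deriv h (P p j) * P' p j) (at 0)"
    if "p \<in> U" for p j
    unfolding along_compose[abs_def] using P' that
    by (intro DERIV_chain2[OF _ P'(2)[rule_format]]) (auto simp: smooth_real_has_derivative compose)
  ultimately show ?case by blast
qed

lemma elementary_imp_diff_fun_on:
  assumes "open U" "elementary U P"
  shows "diff_fun_on U P"
proof (rule diff_fun_on_coinduct[where C = "elementary U"])
  show "finite_order_on U P" by (rule elementary_finite_order[OF assms(2)])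
  show "continuous_on (U \<times> UNIV) (\<lambda>(p, j). Q p j)" if "elementary U Q" for Q
    using that by (rule elementary_continuous)
  show "\<exists>R. elementary U R \<and> (\<forall>p\<in>U. \<forall>j. (along c Q p j has_real_derivative R p j) (at 0))"
    if "elementary U Q" for Q c
    using assms(1) that by (rule elementary_has_derivative)
qed (use assms in simp_all)

locale open_region =
  fixes U :: "point set"
  assumes open_U: "open U"
begin

lemma diff_fun_on_add:
  "diff_fun_on U P \<Longrightarrow> diff_fun_on U Q \<Longrightarrow> diff_fun_on U (\<lambda>p j. P p j + Q p j)"
  by (rule elementary_imp_diff_fun_on[OF open_U elementary.add]) (rule elementary.diff_fun, assumption)+

lemma diff_fun_on_mult:
  "diff_fun_on U P \<Longrightarrow> diff_fun_on U Q \<Longrightarrow> diff_fun_on U (\<lambda>p j. P p j * Q p j)"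
  by (rule elementary_imp_diff_fun_on[OF open_U elementary.mult]) (rule elementary.diff_fun, assumption)+

lemma diff_fun_on_inverse:
  "diff_fun_on U P \<Longrightarrow> (\<And>p j. p \<in> U \<Longrightarrow> P p j \<noteq> 0) \<Longrightarrow> diff_fun_on U (\<lambda>p j. inverse (P p j))"
  by (rule elementary_imp_diff_fun_on[OF open_U elementary.inverse]) (rule elementary.diff_fun)

lemma diff_fun_on_compose:
  "smooth_real h \<Longrightarrow> diff_fun_on U P \<Longrightarrow> diff_fun_on U (\<lambda>p j. h (P p j))"
  by (rule elementary_imp_diff_fun_on[OF open_U elementary.compose]) (rule elementary.diff_fun)

lemma diff_fun_on_uminus: "diff_fun_on U P \<Longrightarrow> diff_fun_on U (\<lambda>p j. - P p j)"
  by (rule diff_fun_on_compose[OF smooth_real_uminus])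

lemma diff_fun_on_diff:
  "diff_fun_on U P \<Longrightarrow> diff_fun_on U Q \<Longrightarrow> diff_fun_on U (\<lambda>p j. P p j - Q p j)"
  using diff_fun_on_add[OF _ diff_fun_on_uminus, of P Q] by simp

lemma diff_fun_on_divide:
  "diff_fun_on U P \<Longrightarrow> diff_fun_on U Q \<Longrightarrow> (\<And>p j. p \<in> U \<Longrightarrow> Q p j \<noteq> 0) \<Longrightarrow>
    diff_fun_on U (\<lambda>p j. P p j / Q p j)"
  using diff_fun_on_mult[OF _ diff_fun_on_inverse, of P Q] by (simp add: divide_inverse)

lemma diff_fun_on_power2: "diff_fun_on U P \<Longrightarrow> diff_fun_on U (\<lambda>p j. (P p j)\<^sup>2)"
  using diff_fun_on_mult[of P P] by (simp add: power2_eq_square)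

text \<open>
  Constants, base coordinates and jet coordinates are treated together, because the affine functions of one
  base and one jet coordinate form a class stable under partial derivatives.
\<close>

lemma diff_fun_on_affine: "diff_fun_on U (\<lambda>p j. a * p $ i + b * j J + c)"
proof (rule diff_fun_on_coinduct[where C = "\<lambda>P. \<exists>a b c. P = (\<lambda>p j. a * p $ i + b * j J + c)", OF open_U])
  show "finite_order_on U (\<lambda>p j. a * p $ i + b * j J + c)"
    unfolding finite_order_on_def by (rule exI[of _ "multi_order J"]) simp
next
  fix P :: dfun
  assume "\<exists>a b c. P = (\<lambda>p j. a * p $ i + b * j J + c)"
  then obtain a b c where P: "P = (\<lambda>p j. a * p $ i + b * j J + c)" by blast
  have "continuous_on (U \<times> UNIV) (\<lambda>x::point \<times> jet. snd x J)"
    by (rule continuous_on_product_then_coordinatewise) (intro continuous_intros)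
  then show "continuous_on (U \<times> UNIV) (\<lambda>(p, j). P p j)"
    unfolding P case_prod_unfold by (intro continuous_intros)
  fix d
  define e where "e = (case d of Base k \<Rightarrow> if k = i then a else 0 | Fibre K \<Rightarrow> if K = J then b else 0)"
  have "along d P p j = (\<lambda>s. P p j + e * s)" for p j
    by (cases d) (auto simp: P e_def axis_def algebra_simps fun_eq_iff)
  then have "(along d P p j has_real_derivative e) (at 0)" for p j
    by (auto intro!: derivative_eq_intros)
  then have "\<forall>p\<in>U. \<forall>j. (along d P p j has_real_derivative 0 * p $ i + 0 * j J + e) (at 0)"
    by simp
  then show "\<exists>Q. (\<exists>a b c. Q = (\<lambda>p j. a * p $ i + b * j J + c)) \<and>
      (\<forall>p\<in>U. \<forall>j. (along d P p j has_real_derivative Q p j) (at 0))"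
    by (intro exI[of _ "\<lambda>p j. 0 * p $ i + 0 * j J + e"]) blast
qed blast

lemma diff_fun_on_const: "diff_fun_on U (\<lambda>p j. c)"
  using diff_fun_on_affine[of 0 0 0 0 c] by simp

lemma diff_fun_on_base_coord: "diff_fun_on U (\<lambda>p j. p $ i)"
  using diff_fun_on_affine[of 1 i 0 0 0] by simp

lemma diff_fun_on_jet_coord: "diff_fun_on U (\<lambda>p j. j J)"
  using diff_fun_on_affine[of 0 0 1 J 0] by simp

lemma smooth_on_partial: "smooth_on U g \<Longrightarrow> smooth_on U (partial i g)"
proof -
  have "foldr partial is (partial i g) = foldr partial (is @ [i]) g" for "is" by simp
  then show "smooth_on U g \<Longrightarrow> smooth_on U (partial i g)"
    unfolding smooth_on_def by metis
qed

lemma smooth_on_zero: "smooth_on U (\<lambda>p. 0)"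
proof -
  have "partial i (\<lambda>p. 0) = (\<lambda>p. 0)" for i by (simp add: partial_def fun_eq_iff)
  then have "foldr partial is (\<lambda>p. 0) = (\<lambda>p. 0)" for "is" by (induction "is") auto
  then show ?thesis by (simp add: smooth_on_def)
qed

lemma smooth_on_has_partial:
  assumes "smooth_on U g" "p \<in> U"
  shows "((\<lambda>s. g (p + s *\<^sub>R axis i 1)) has_real_derivative partial i g p) (at 0)"
proof -
  have "g differentiable_on U" using assms(1) unfolding smooth_on_def by (metis foldr_Nil id_apply)
  then have "g differentiable at p"
    using assms(2) open_U by (simp add: differentiable_on_eq_differentiable_at)
  then have "g differentiable at ((\<lambda>s. p + s *\<^sub>R axis i (1::real)) 0)" by simp
  moreover have "(\<lambda>s. p + s *\<^sub>R axis i (1::real)) differentiable at 0"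
    by (intro derivative_intros)
  ultimately have "(g \<circ> (\<lambda>s. p + s *\<^sub>R axis i 1)) differentiable at 0"
    by (rule differentiable_chain_at[rotated])
  then show ?thesis
    unfolding partial_def by (simp add: DERIV_deriv_iff_real_differentiable o_def)
qed

lemma diff_fun_on_base:
  assumes "smooth_on U g"
  shows "diff_fun_on U (\<lambda>p j. g p)"
proof (rule diff_fun_on_coinduct[where C = "\<lambda>P. \<exists>g. smooth_on U g \<and> P = (\<lambda>p j. g p)", OF open_U])
  show "finite_order_on U (\<lambda>p j. g p)" by (simp add: finite_order_on_def)
next
  fix P :: dfun
  assume "\<exists>g. smooth_on U g \<and> P = (\<lambda>p j. g p)"
  then obtain g where g: "smooth_on U g" and P: "P = (\<lambda>p j. g p)" by blast
  have "continuous_on U g"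
    using g unfolding smooth_on_def by (metis foldr_Nil id_apply differentiable_imp_continuous_on)
  then show "continuous_on (U \<times> UNIV) (\<lambda>(p, j). P p j)"
    unfolding P case_prod_unfold by (rule continuous_on_compose2) (auto intro: continuous_intros)
  fix d
  show "\<exists>Q. (\<exists>g. smooth_on U g \<and> Q = (\<lambda>p j. g p)) \<and>
      (\<forall>p\<in>U. \<forall>j. (along d P p j has_real_derivative Q p j) (at 0))"
  proof (cases d)
    case (Base i)
    have "along d P p j = (\<lambda>s. g (p + s *\<^sub>R axis i 1))" for p j
      by (simp add: Base P fun_eq_iff)
    then show ?thesis
      using smooth_on_partial[OF g] smooth_on_has_partial[OF g]
      by (intro exI[of _ "\<lambda>p j. partial i g p"]) auto
  next
    case (Fibre J)
    have "along d P p j = (\<lambda>s. g p)" for p j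
      by (simp add: Fibre P fun_eq_iff)
    then show ?thesis
      using smooth_on_zero by (intro exI[of _ "\<lambda>p j. 0"]) auto
  qed
qed (use assms in blast)

lemmas diff_fun_on_intros = diff_fun_on_add diff_fun_on_mult diff_fun_on_uminus diff_fun_on_diff
  diff_fun_on_divide diff_fun_on_power2 diff_fun_on_const diff_fun_on_base_coord diff_fun_on_jet_coord
  diff_fun_on_compose[OF smooth_real_sin] diff_fun_on_compose[OF smooth_real_cos]

lemma diff_fun_on_sum:
  assumes "\<And>k. k \<in> A \<Longrightarrow> diff_fun_on U (P k)"
  shows "diff_fun_on U (\<lambda>p j. \<Sum>k\<in>A. P k p j)"
  using assms
proof (induction A rule: infinite_finite_induct)
  case (insert a A)
  then show ?case using diff_fun_on_add[of "P a" "\<lambda>p j. \<Sum>k\<in>A. P k p j"] by simp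
qed (simp_all add: diff_fun_on_const)

section \<open>Total derivatives\<close>

lemma pd_add:
  assumes "diff_fun_on U P" "diff_fun_on U Q" "p \<in> U"
  shows "pd c (\<lambda>p j. P p j + Q p j) p j = pd c P p j + pd c Q p j"
  unfolding pd_def[of c "\<lambda>p j. P p j + Q p j"] along_add[abs_def]
  by (intro DERIV_imp_deriv DERIV_add diff_fun_on_has_derivative[OF assms(1,3)]
      diff_fun_on_has_derivative[OF assms(2,3)])

lemma pd_mult:
  assumes "diff_fun_on U P" "diff_fun_on U Q" "p \<in> U"
  shows "pd c (\<lambda>p j. P p j * Q p j) p j = pd c P p j * Q p j + pd c Q p j * P p j"
proof -
  note D = diff_fun_on_has_derivative[OF assms(1,3), of c j] diff_fun_on_has_derivative[OF assms(2,3), of c j]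
  show ?thesis
    using DERIV_imp_deriv[OF DERIV_mult[OF D]]
    by (simp add: pd_def[of c "\<lambda>p j. P p j * Q p j"] along_mult[abs_def])
qed

lemma pd_Fibre_eq_0:
  assumes "\<And>j j'. (\<forall>J. multi_order J \<le> n \<longrightarrow> j J = j' J) \<Longrightarrow> P p j = P p j'" "n < multi_order J"
  shows "pd (Fibre J) P p j = 0"
proof -
  have "along (Fibre J) P p j = (\<lambda>s. P p j)"
    using assms by (auto simp: fun_eq_iff intro!: assms(1))
  then show ?thesis by (simp add: pd_def)
qed

text \<open>
  This makes the sum in the definition of the total derivative a genuine finite sum.
\<close>

lemma finite_fibre_support:
  assumes "diff_fun_on U P" "p \<in> U"
  shows "finite {J. pd (Fibre J) P p j \<noteq> 0}"
proof -
  obtain n where n: "\<And>j j'. (\<forall>J. multi_order J \<le> n \<longrightarrow> j J = j' J) \<Longrightarrow> P p j = P p j'"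
    using diff_fun_on_finite_order[OF assms(1)] assms(2) unfolding finite_order_on_def by metis
  have "{J. pd (Fibre J) P p j \<noteq> 0} \<subseteq> {J. multi_order J \<le> n}"
    using pd_Fibre_eq_0[of n P p, OF n] by (auto simp: not_le[symmetric])
  then show ?thesis using finite_multi_order_le finite_subset by blast
qed

text \<open>
  The index set of the defining sum depends on the function and on the point. Replacing it by any larger
  finite set allows the total derivatives of several functions to be compared term by term.
\<close>

lemma total_deriv_eq_sum:
  assumes "finite S" "\<And>J. J \<notin> S \<Longrightarrow> pd (Fibre J) P p j = 0"
  shows "total_deriv i P p j = pd (Base i) P p j + (\<Sum>J\<in>S. j (J + E i) * pd (Fibre J) P p j)"
  unfolding total_deriv_def using assms
  by (subst sum.mono_neutral_left[of S "{J. pd (Fibre J) P p j \<noteq> 0}"]) auto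

lemma total_deriv_add:
  assumes "diff_fun_on U P" "diff_fun_on U Q" "p \<in> U"
  shows "total_deriv i (\<lambda>p j. P p j + Q p j) p j = total_deriv i P p j + total_deriv i Q p j"
proof -
  define S where "S = {J. pd (Fibre J) P p j \<noteq> 0} \<union> {J. pd (Fibre J) Q p j \<noteq> 0}"
  have S: "finite S" using assms finite_fibre_support by (simp add: S_def)
  note eq = total_deriv_eq_sum[OF S, of _ p j i]
  have "total_deriv i (\<lambda>p j. P p j + Q p j) p j = pd (Base i) (\<lambda>p j. P p j + Q p j) p j
      + (\<Sum>J\<in>S. j (J + E i) * pd (Fibre J) (\<lambda>p j. P p j + Q p j) p j)"
    by (rule eq) (simp add: pd_add[OF assms] S_def)
  moreover have "total_deriv i P p j = pd (Base i) P p j + (\<Sum>J\<in>S. j (J + E i) * pd (Fibre J) P p j)"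
    by (rule eq) (simp add: S_def)
  moreover have "total_deriv i Q p j = pd (Base i) Q p j + (\<Sum>J\<in>S. j (J + E i) * pd (Fibre J) Q p j)"
    by (rule eq) (simp add: S_def)
  ultimately show ?thesis
    by (simp add: pd_add[OF assms] sum.distrib algebra_simps)
qed

lemma total_deriv_mult:
  assumes "diff_fun_on U P" "diff_fun_on U Q" "p \<in> U"
  shows "total_deriv i (\<lambda>p j. P p j * Q p j) p j
    = total_deriv i P p j * Q p j + P p j * total_deriv i Q p j"
proof -
  define S where "S = {J. pd (Fibre J) P p j \<noteq> 0} \<union> {J. pd (Fibre J) Q p j \<noteq> 0}"
  have S: "finite S" using assms finite_fibre_support by (simp add: S_def)
  note eq = total_deriv_eq_sum[OF S, of _ p j i]
  have "total_deriv i (\<lambda>p j. P p j * Q p j) p j = pd (Base i) (\<lambda>p j. P p j * Q p j) p j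
      + (\<Sum>J\<in>S. j (J + E i) * pd (Fibre J) (\<lambda>p j. P p j * Q p j) p j)"
    by (rule eq) (simp add: pd_mult[OF assms] S_def)
  moreover have "total_deriv i P p j = pd (Base i) P p j + (\<Sum>J\<in>S. j (J + E i) * pd (Fibre J) P p j)"
    by (rule eq) (simp add: S_def)
  moreover have "total_deriv i Q p j = pd (Base i) Q p j + (\<Sum>J\<in>S. j (J + E i) * pd (Fibre J) Q p j)"
    by (rule eq) (simp add: S_def)
  ultimately show ?thesis
    by (simp add: pd_mult[OF assms] sum.distrib sum_distrib_left sum_distrib_right algebra_simps)
qed

lemma total_deriv_base: "total_deriv i (\<lambda>p j. g p) p j = partial i g p"
proof -
  have "along (Fibre J) (\<lambda>p j. g p) p j = (\<lambda>s. g p)"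
    "along (Base i) (\<lambda>p j. g p) p j = (\<lambda>s. g (p + s *\<^sub>R axis i 1))" for J
    by (simp_all add: fun_eq_iff)
  then show ?thesis
    by (simp add: total_deriv_def pd_def partial_def)
qed

lemma total_deriv_const: "total_deriv i (\<lambda>p j. c) p j = 0"
  by (simp add: total_deriv_base partial_def)

lemma total_deriv_jet_coord: "total_deriv i (\<lambda>p j. j J) p j = j (J + E i)"
proof -
  have "along (Base i) (\<lambda>p j. j J) p j = (\<lambda>s. j J)"
    "along (Fibre K) (\<lambda>p j. j J) p j = (\<lambda>s. if K = J then j J + s else j J)" for K
    by (auto simp: fun_eq_iff)
  moreover have "deriv (\<lambda>s. j J + s) 0 = 1"
    by (rule DERIV_imp_deriv) (auto intro!: derivative_eq_intros)
  ultimately have "pd (Base i) (\<lambda>p j. j J) p j = 0"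
    "pd (Fibre K) (\<lambda>p j. j J) p j = (if K = J then 1 else 0)" for K
    by (auto simp: pd_def)
  then show ?thesis
    by (subst total_deriv_eq_sum[of "{J}"]) auto
qed

lemma total_deriv_cong:
  assumes "p \<in> U" "\<And>p j. p \<in> U \<Longrightarrow> P p j = Q p j"
  shows "total_deriv i P p j = total_deriv i Q p j"
  unfolding total_deriv_def using pd_cong[OF open_U assms(1), of P Q] assms(2) by simp

lemma total_deriv_uminus:
  assumes "diff_fun_on U P" "p \<in> U"
  shows "total_deriv i (\<lambda>p j. - P p j) p j = - total_deriv i P p j"
  using total_deriv_mult[OF diff_fun_on_const[of "-1"] assms]
  by (simp add: total_deriv_const)

lemma total_deriv_diff:
  assumes "diff_fun_on U P" "diff_fun_on U Q" "p \<in> U"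
  shows "total_deriv i (\<lambda>p j. P p j - Q p j) p j = total_deriv i P p j - total_deriv i Q p j"
  using total_deriv_add[OF assms(1) diff_fun_on_uminus[OF assms(2)] assms(3)]
  by (simp add: total_deriv_uminus assms)

lemma total_deriv_sum:
  assumes "\<And>k. k \<in> A \<Longrightarrow> diff_fun_on U (P k)" "p \<in> U"
  shows "total_deriv i (\<lambda>p j. \<Sum>k\<in>A. P k p j) p j = (\<Sum>k\<in>A. total_deriv i (P k) p j)"
  using assms(1)
proof (induction A rule: infinite_finite_induct)
  case (insert a A)
  have "total_deriv i (\<lambda>p j. P a p j + (\<Sum>k\<in>A. P k p j)) p j
      = total_deriv i (P a) p j + total_deriv i (\<lambda>p j. \<Sum>k\<in>A. P k p j) p j"
    by (rule total_deriv_add) (use insert.prems assms(2) in \<open>auto intro: diff_fun_on_sum\<close>)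
  then show ?case using insert by simp
qed (simp_all add: total_deriv_const)

lemma total_deriv_first_order:
  assumes "\<And>j j'. (\<forall>J. multi_order J \<le> 1 \<longrightarrow> j J = j' J) \<Longrightarrow> L p j = L p j'"
  shows "total_deriv i L p j = pd (Base i) L p j + j (E i) * pd (Fibre 0) L p j
    + (\<Sum>k\<in>UNIV. j (E k + E i) * pd (Fibre (E k)) L p j)"
proof -
  have "total_deriv i L p j = pd (Base i) L p j
      + (\<Sum>J\<in>insert 0 (range E). j (J + E i) * pd (Fibre J) L p j)"
  proof (rule total_deriv_eq_sum)
    fix J assume "J \<notin> insert 0 (range E)"
    then have "1 < multi_order J" using multi_order_le_1[of J] by auto
    then show "pd (Fibre J) L p j = 0" by (intro pd_Fibre_eq_0[of 1 L p]) (rule assms)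
  qed simp
  also have "(\<Sum>J\<in>insert 0 (range E). j (J + E i) * pd (Fibre J) L p j)
      = j (E i) * pd (Fibre 0) L p j + (\<Sum>J\<in>range E. j (J + E i) * pd (Fibre J) L p j)"
    by (subst sum.insert) auto
  also have "(\<Sum>J\<in>range E. j (J + E i) * pd (Fibre J) L p j)
      = (\<Sum>k\<in>UNIV. j (E k + E i) * pd (Fibre (E k)) L p j)"
    by (subst sum.reindex) (auto simp: inj_on_def)
  finally show ?thesis by simp
qed

section \<open>Noether's theorem for first-order Lagrangians\<close>

text \<open>
  For a first-order Lagrangian the Euler operator \<open>\<delta>L/\<delta>u\<close> has only these terms.
\<close>

definition euler_lagrange :: "dfun \<Rightarrow> dfun" where
  "euler_lagrange L p j =
     pd (Fibre 0) L p j - (\<Sum>i\<in>UNIV. total_deriv i (pd (Fibre (E i)) L) p j)"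

text \<open>
  The algebraic core of Noether's theorem at one point of the jet space, where every derivative is an
  independent number: \<open>u i\<close> stands for \<open>u\<^sub>i\<close>, \<open>uu k i\<close> for \<open>u\<^sub>k\<^sub>i\<close>, \<open>D\<xi> k i\<close> for \<open>D\<^sub>i \<xi>\<^sup>k\<close>, and \<open>Lp i\<close> for \<open>\<partial>L/\<partial>u\<^sub>i\<close>.
  The symmetry of \<open>uu\<close> makes the second-order terms of \<open>\<xi>\<^sup>i D\<^sub>i L\<close> and \<open>D\<^sub>i (\<xi>\<^sup>k u\<^sub>k) \<partial>L/\<partial>u\<^sub>i\<close> cancel.
\<close>

lemma noether_algebra:
  fixes \<xi> Lx u Lp D\<eta> DLp :: "3 \<Rightarrow> real" and D\<xi> uu :: "3 \<Rightarrow> 3 \<Rightarrow> real" and \<eta> Lu L :: real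
  assumes "\<And>i k. uu i k = uu k i"
  shows "(\<Sum>i\<in>UNIV. D\<xi> i i * L + \<xi> i * (Lx i + u i * Lu + (\<Sum>k\<in>UNIV. uu k i * Lp k))
      + ((D\<eta> i - (\<Sum>k\<in>UNIV. D\<xi> k i * u k + \<xi> k * uu k i)) * Lp i + (\<eta> - (\<Sum>k\<in>UNIV. \<xi> k * u k)) * DLp i))
    = ((\<Sum>i\<in>UNIV. \<xi> i * Lx i) + \<eta> * Lu + (\<Sum>i\<in>UNIV. (D\<eta> i - (\<Sum>k\<in>UNIV. u k * D\<xi> k i)) * Lp i)
       + L * (\<Sum>i\<in>UNIV. D\<xi> i i)) - (\<eta> - (\<Sum>k\<in>UNIV. \<xi> k * u k)) * (Lu - (\<Sum>i\<in>UNIV. DLp i))"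
  unfolding sum_UNIV_three using assms[of 0 1] assms[of 0 2] assms[of 1 2]
  by (simp add: algebra_simps)

lemma diff_fun_on_noether_current:
  assumes "diff_fun_on U L" "noether_symmetry_with U L X V"
  shows "diff_fun_on U (noether_current L X V i)"
  unfolding noether_current_def[abs_def] using assms
  by (intro diff_fun_on_intros diff_fun_on_sum diff_fun_on_pd open_U) (auto simp: noether_symmetry_with_def)

text \<open>
  Noether's identity. It holds on all jets: the product rule turns the divergence of the current into
  the expression of the symmetry condition, which cancels against \<open>Div V\<close>, plus a multiple of the
  Euler-Lagrange expression.
\<close>

theorem Div_noether_current:
  assumes L: "diff_fun_on U L"
    and first_order: "\<And>j j'. (\<forall>J. multi_order J \<le> 1 \<longrightarrow> j J = j' J) \<Longrightarrow> L p j = L p j'"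
    and X: "noether_symmetry_with U L X V" and p: "p \<in> U"
  shows "Div (noether_current L X V) p j
    = ((\<Sum>k\<in>UNIV. xi X k p j * j (E k)) - eta X p j) * euler_lagrange L p j"
proof -
  have xi: "diff_fun_on U (xi X i)" and eta: "diff_fun_on U (eta X)" and V: "diff_fun_on U (V i)"
    and sym: "prolong1 X L p j + L p j * (\<Sum>i\<in>UNIV. total_deriv i (xi X i) p j) = Div V p j" for i
    using X p by (auto simp: noether_symmetry_with_def)
  note Lp = diff_fun_on_pd[OF open_U L]
  note diffs = xi eta V L Lp diff_fun_on_add diff_fun_on_mult diff_fun_on_diff diff_fun_on_sum
    diff_fun_on_jet_coord
  \<comment> \<open>the characteristic of the vector field: the infinitesimal change of \<open>u\<close> at a fixed base point\<close>
  define W where "W = (\<lambda>p j. eta X p j - (\<Sum>k\<in>UNIV. xi X k p j * j (E k)))"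
  have W_p: "W p j = eta X p j - (\<Sum>k\<in>UNIV. xi X k p j * j (E k))" by (simp add: W_def)
  have DL: "total_deriv i L p j = pd (Base i) L p j + j (E i) * pd (Fibre 0) L p j
      + (\<Sum>k\<in>UNIV. j (E k + E i) * pd (Fibre (E k)) L p j)" for i
    by (rule total_deriv_first_order) (rule first_order)
  have W: "diff_fun_on U W" unfolding W_def by (intro diffs)
  have DW: "total_deriv i W p j = total_deriv i (eta X) p j
      - (\<Sum>k\<in>UNIV. total_deriv i (xi X k) p j * j (E k) + xi X k p j * j (E k + E i))" for i
  proof -
    have "total_deriv i W p j = total_deriv i (eta X) p j
        - total_deriv i (\<lambda>p j. \<Sum>k\<in>UNIV. xi X k p j * j (E k)) p j"
      unfolding W_def by (intro total_deriv_diff diffs p)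
    also have "total_deriv i (\<lambda>p j. \<Sum>k\<in>UNIV. xi X k p j * j (E k)) p j
        = (\<Sum>k\<in>UNIV. total_deriv i (\<lambda>p j. xi X k p j * j (E k)) p j)"
      by (intro total_deriv_sum diffs p)
    also have "\<dots> = (\<Sum>k\<in>UNIV. total_deriv i (xi X k) p j * j (E k) + xi X k p j * j (E k + E i))"
      by (simp add: total_deriv_mult[OF xi diff_fun_on_jet_coord p] total_deriv_jet_coord)
    finally show ?thesis .
  qed
  have DN: "total_deriv i (noether_current L X V i) p j =
      total_deriv i (xi X i) p j * L p j + xi X i p j * total_deriv i L p j
      + (total_deriv i W p j * pd (Fibre (E i)) L p j + W p j * total_deriv i (pd (Fibre (E i)) L) p j)
      - total_deriv i (V i) p j" for i
  proof -
    have "total_deriv i (noether_current L X V i) p j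
        = total_deriv i (\<lambda>p j. xi X i p j * L p j + W p j * pd (Fibre (E i)) L p j - V i p j) p j"
      by (simp add: noether_current_def[abs_def] W_def)
    also have "\<dots> = total_deriv i (\<lambda>p j. xi X i p j * L p j + W p j * pd (Fibre (E i)) L p j) p j
        - total_deriv i (V i) p j"
      by (intro total_deriv_diff diffs W p)
    also have "total_deriv i (\<lambda>p j. xi X i p j * L p j + W p j * pd (Fibre (E i)) L p j) p j
        = total_deriv i (\<lambda>p j. xi X i p j * L p j) p j + total_deriv i (\<lambda>p j. W p j * pd (Fibre (E i)) L p j) p j"
      by (intro total_deriv_add diffs W p)
    finally show ?thesis
      by (simp add: total_deriv_mult[OF xi L p] total_deriv_mult[OF W Lp p])
  qed
  have "Div (noether_current L X V) p j = (\<Sum>i\<in>UNIV.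
      total_deriv i (xi X i) p j * L p j + xi X i p j * total_deriv i L p j
      + (total_deriv i W p j * pd (Fibre (E i)) L p j + W p j * total_deriv i (pd (Fibre (E i)) L) p j))
      - Div V p j"
    by (simp add: Div_def DN sum_subtractf)
  also have "(\<Sum>i\<in>UNIV.
      total_deriv i (xi X i) p j * L p j + xi X i p j * total_deriv i L p j
      + (total_deriv i W p j * pd (Fibre (E i)) L p j + W p j * total_deriv i (pd (Fibre (E i)) L) p j))
      = prolong1 X L p j + L p j * (\<Sum>i\<in>UNIV. total_deriv i (xi X i) p j) - W p j * euler_lagrange L p j"
    unfolding DW DL W_p prolong1_def eta1_def euler_lagrange_def
    by (rule noether_algebra[where uu = "\<lambda>k i. j (E k + E i)" and u = "\<lambda>k. j (E k)"
        and \<xi> = "\<lambda>i. xi X i p j" and D\<xi> = "\<lambda>k i. total_deriv i (xi X k) p j"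
        and \<eta> = "eta X p j" and D\<eta> = "\<lambda>i. total_deriv i (eta X) p j"
        and L = "L p j" and Lx = "\<lambda>i. pd (Base i) L p j" and Lu = "pd (Fibre 0) L p j"
        and Lp = "\<lambda>i. pd (Fibre (E i)) L p j" and DLp = "\<lambda>i. total_deriv i (pd (Fibre (E i)) L) p j"])
      (simp add: add.commute)
  finally show ?thesis using sym by (simp add: W_p left_diff_distrib)
qed

end

lemma three_distinct [simp]: "(2::3) \<noteq> 0" "(2::3) \<noteq> 1" "(0::3) \<noteq> 2" "(1::3) \<noteq> 2"
  by simp_all

section \<open>The wave equation and its Lagrangian\<close>

lemma sin_pos_strip: "p \<in> strip \<Longrightarrow> 0 < sin (p $ 1)"
  by (simp add: strip_def sin_gt_zero)

lemma partial_compose_coord: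
  assumes "(h has_real_derivative h') (at (p $ k))"
  shows "partial i (\<lambda>p. h (p $ k)) p = (if i = k then h' else 0)"
proof (cases "i = k")
  case True
  have "((\<lambda>s. h (p $ k + s)) has_real_derivative h') (at 0)"
    using assms DERIV_at_within_shift[of h h' "p $ k" 0 UNIV] by simp
  then show ?thesis using True by (simp add: partial_def axis_def DERIV_imp_deriv)
qed (simp add: partial_def axis_def)

lemma pd_fibre_lagrangian:
  assumes "\<And>v. (F has_real_derivative f v) (at v)"
  shows "pd (Fibre 0) (lagrangian F) = (\<lambda>p j. sin (p $ 1) * f (j 0))"
    and "pd (Fibre (E 0)) (lagrangian F) = (\<lambda>p j. sin (p $ 1) * j (E 0))"
    and "pd (Fibre (E 1)) (lagrangian F) = (\<lambda>p j. - sin (p $ 1) * j (E 1))"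
    and "pd (Fibre (E 2)) (lagrangian F) = (\<lambda>p j. - inverse (sin (p $ 1)) * j (E 2))"
proof -
  have "((\<lambda>s. F (v + s)) has_real_derivative f v) (at 0)" for v
    using assms[of v] DERIV_at_within_shift[of F "f v" v 0 UNIV] by simp
  then show "pd (Fibre 0) (lagrangian F) = (\<lambda>p j. sin (p $ 1) * f (j 0))"
    by (intro ext) (auto simp: pd_def along_Fibre lagrangian_def intro!: DERIV_imp_deriv derivative_eq_intros)
  \<comment> \<open>the Lagrangian is quadratic in each first derivative\<close>
  have quadratic: "deriv (\<lambda>s. a + k * ((v + s)\<^sup>2 - v\<^sup>2) / 2) 0 = k * v" for a k v :: real
    by (rule DERIV_imp_deriv) (auto intro!: derivative_eq_intros)
  have "lagrangian F p (j(E 0 := j (E 0) + s)) = lagrangian F p j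
      + sin (p $ 1) * ((j (E 0) + s)\<^sup>2 - (j (E 0))\<^sup>2) / 2" for p j s
    by (simp add: lagrangian_def right_diff_distrib diff_divide_distrib)
  then show "pd (Fibre (E 0)) (lagrangian F) = (\<lambda>p j. sin (p $ 1) * j (E 0))"
    by (simp only: fun_eq_iff pd_def along_Fibre quadratic simp_thms)
  have "lagrangian F p (j(E 1 := j (E 1) + s)) = lagrangian F p j
      + - sin (p $ 1) * ((j (E 1) + s)\<^sup>2 - (j (E 1))\<^sup>2) / 2" for p j s
    by (simp add: lagrangian_def right_diff_distrib diff_divide_distrib)
  then show "pd (Fibre (E 1)) (lagrangian F) = (\<lambda>p j. - sin (p $ 1) * j (E 1))"
    by (simp only: fun_eq_iff pd_def along_Fibre quadratic simp_thms)
  have "lagrangian F p (j(E 2 := j (E 2) + s)) = lagrangian F p j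
      + - inverse (sin (p $ 1)) * ((j (E 2) + s)\<^sup>2 - (j (E 2))\<^sup>2) / 2" for p j s
    by (simp add: lagrangian_def inverse_eq_divide diff_divide_distrib)
  then show "pd (Fibre (E 2)) (lagrangian F) = (\<lambda>p j. - inverse (sin (p $ 1)) * j (E 2))"
    by (simp only: fun_eq_iff pd_def along_Fibre quadratic simp_thms)
qed

lemma pd_base_lagrangian:
  shows "pd (Base 0) (lagrangian F) p j = 0" and "pd (Base 2) (lagrangian F) p j = 0"
    and "sin (p $ 1) \<noteq> 0 \<Longrightarrow> pd (Base 1) (lagrangian F) p j =
      cos (p $ 1) * ((j (E 0))\<^sup>2 / 2 - (j (E 1))\<^sup>2 / 2 + (j (E 2))\<^sup>2 / (2 * (sin (p $ 1))\<^sup>2) + F (j 0))"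
proof -
  have "along (Base i) (lagrangian F) p j = (\<lambda>s. lagrangian F p j)" if "i \<noteq> 1" for i
    using that by (simp add: fun_eq_iff lagrangian_def axis_def)
  then show "pd (Base 0) (lagrangian F) p j = 0" and "pd (Base 2) (lagrangian F) p j = 0"
    by (simp_all add: pd_def)
  assume "sin (p $ 1) \<noteq> 0"
  then have "((\<lambda>s. lagrangian F (p + s *\<^sub>R axis 1 1) j) has_real_derivative
      cos (p $ 1) * ((j (E 0))\<^sup>2 / 2 - (j (E 1))\<^sup>2 / 2 + (j (E 2))\<^sup>2 / (2 * (sin (p $ 1))\<^sup>2) + F (j 0))) (at 0)"
    unfolding lagrangian_def
    by - (rule derivative_eq_intros refl | simp add: axis_def field_simps power2_eq_square)+
  then show "pd (Base 1) (lagrangian F) p j =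
      cos (p $ 1) * ((j (E 0))\<^sup>2 / 2 - (j (E 1))\<^sup>2 / 2 + (j (E 2))\<^sup>2 / (2 * (sin (p $ 1))\<^sup>2) + F (j 0))"
    unfolding pd_def along_Base by (rule DERIV_imp_deriv)
qed

lemma lagrangian_first_order:
  assumes "\<forall>J. multi_order J \<le> 1 \<longrightarrow> j J = j' J"
  shows "lagrangian F p j = lagrangian F p j'"
proof -
  have "j 0 = j' 0" "j (E k) = j' (E k)" for k
    using assms multi_order_le_1 by blast+
  then show ?thesis by (simp add: lagrangian_def)
qed

lemma jet_of_simps:
  "jet_of u p 0 = u p" "jet_of u p (E i) = partial i u p" "jet_of u p (E i + E i) = partial i (partial i u) p"
  using three_cases[of i] by (auto simp: jet_of_def E_nth numeral_2_eq_2)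

text \<open>
  The next two lemmas do the arithmetic for the rotations with the quantities replaced by real numbers:
  \<open>s\<close> and \<open>c\<close> for \<open>sin x\<close> and \<open>cos x\<close>, \<open>g\<close> and \<open>g'\<close> for the values at \<open>y\<close>, \<open>a, b, d\<close> for \<open>u\<^sub>t, u\<^sub>x, u\<^sub>y\<close>, and \<open>\<Phi>\<close> for
  \<open>F(u)\<close>. The identity \<open>s\<^sup>2 + c\<^sup>2 = 1\<close> is already used up in the derivative of the cotangent.
\<close>

lemma rotation_invariance_algebra:
  fixes s c g g' a b d \<Phi> :: real
  assumes "s \<noteq> 0"
  shows "g * (c * (a\<^sup>2 / 2 - b\<^sup>2 / 2 + d\<^sup>2 / (2 * s\<^sup>2) + \<Phi>))
      + d * inverse (s\<^sup>2) * g' * (- s * b)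
      - (b * g' - d * (c / s * g)) * (- inverse s * d)
      - (s / 2 * a\<^sup>2 - s / 2 * b\<^sup>2 - 1 / (2 * s) * d\<^sup>2 + s * \<Phi>) * (c / s * g) = 0"
  using assms by (simp add: field_simps power2_eq_square)

lemma rotation_current_algebra:
  fixes s c g g' a b d \<Phi> :: real
  assumes "s \<noteq> 0"
  shows "0 * (s / 2 * a\<^sup>2 - s / 2 * b\<^sup>2 - 1 / (2 * s) * d\<^sup>2 + s * \<Phi>)
      - (0 * a + g * b + c / s * g' * d) * (s * a)
      = - (s * g * a * b) - c * g' * a * d"
    and "g * (s / 2 * a\<^sup>2 - s / 2 * b\<^sup>2 - 1 / (2 * s) * d\<^sup>2 + s * \<Phi>)
      - (0 * a + g * b + c / s * g' * d) * (- s * b)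
      = s * g / 2 * a\<^sup>2 + s * g / 2 * b\<^sup>2 - g / (2 * s) * d\<^sup>2 + c * g' * b * d + s * g * \<Phi>"
    and "c / s * g' * (s / 2 * a\<^sup>2 - s / 2 * b\<^sup>2 - 1 / (2 * s) * d\<^sup>2 + s * \<Phi>)
      - (0 * a + g * b + c / s * g' * d) * (- inverse s * d)
      = c * g' / 2 * a\<^sup>2 - c * g' / 2 * b\<^sup>2 + c * g' / (2 * s\<^sup>2) * d\<^sup>2 + g / s * b * d + c * g' * \<Phi>"
  using assms by (simp_all add: field_simps power2_eq_square)

locale wave_equation = open_region U for U +
  fixes f F :: "real \<Rightarrow> real"
  assumes smooth_f: "smooth_real f"
    and F_deriv: "\<And>v. (F has_real_derivative f v) (at v)"
    and U_strip: "U \<subseteq> strip"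
begin

lemma sin_pos: "p \<in> U \<Longrightarrow> 0 < sin (p $ 1)"
  using U_strip sin_pos_strip by blast

lemma sin_nonzero: "p \<in> U \<Longrightarrow> sin (p $ 1) \<noteq> 0"
  using sin_pos by force

lemma diff_fun_on_cot: "diff_fun_on U (\<lambda>p j. cot (p $ 1))"
  unfolding cot_def by (intro diff_fun_on_intros) (rule sin_nonzero)

lemma diff_fun_on_lagrangian: "diff_fun_on U (lagrangian F)"
  unfolding lagrangian_def[abs_def]
  by (intro diff_fun_on_intros diff_fun_on_compose[OF smooth_real_antiderivative[OF smooth_f F_deriv]])
    (simp_all add: sin_nonzero)

lemma total_deriv_base_times_jet_coord:
  assumes "diff_fun_on U (\<lambda>p j. g p)" "p \<in> U"
  shows "total_deriv i (\<lambda>p j. g p * j J) p j = partial i g p * j J + g p * j (J + E i)"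
  by (simp add: total_deriv_mult[OF assms(1) diff_fun_on_jet_coord assms(2)]
      total_deriv_base total_deriv_jet_coord)

lemma diff_fun_on_sin: "diff_fun_on U (\<lambda>p j. sin (p $ 1))" "diff_fun_on U (\<lambda>p j. - sin (p $ 1))"
    "diff_fun_on U (\<lambda>p j. - inverse (sin (p $ 1)))"
  by (intro diff_fun_on_intros diff_fun_on_inverse sin_nonzero; assumption)+

lemma partial_sin:
  assumes "p \<in> U"
  shows "partial 0 (\<lambda>p. sin (p $ 1)) p = 0" "partial 1 (\<lambda>p. - sin (p $ 1)) p = - cos (p $ 1)"
    "partial 2 (\<lambda>p. - inverse (sin (p $ 1))) p = 0"
  using sin_nonzero[OF assms]
    partial_compose_coord[OF DERIV_sin, where i = 0 and k = 1]
    partial_compose_coord[OF DERIV_minus[OF DERIV_sin], where i = 1 and k = 1]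
    partial_compose_coord[OF DERIV_minus[OF DERIV_inverse'[OF DERIV_sin]], where i = 2 and k = 1]
  by simp_all

text \<open>
  The factor \<open>sin x\<close> in the Lagrangian is the volume density of the sphere. Differentiating it in the
  \<open>x\<close>-term of the Lagrangian produces the first-order term \<open>cot x u\<^sub>x\<close> of the equation.
\<close>

lemma euler_lagrange_lagrangian:
  assumes p: "p \<in> U"
  shows "euler_lagrange (lagrangian F) p j = sin (p $ 1) *
    (f (j 0) - j (E 0 + E 0) + j (E 1 + E 1) + cot (p $ 1) * j (E 1) + j (E 2 + E 2) / (sin (p $ 1))\<^sup>2)"
proof -
  note diff = diff_fun_on_sin and D = partial_sin[OF p]
  have "total_deriv 0 (\<lambda>p j. sin (p $ 1) * j (E 0)) p j = sin (p $ 1) * j (E 0 + E 0)"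
    "total_deriv 1 (\<lambda>p j. - sin (p $ 1) * j (E 1)) p j
      = - cos (p $ 1) * j (E 1) - sin (p $ 1) * j (E 1 + E 1)"
    "total_deriv 2 (\<lambda>p j. - inverse (sin (p $ 1)) * j (E 2)) p j = - inverse (sin (p $ 1)) * j (E 2 + E 2)"
    by (simp_all only: total_deriv_base_times_jet_coord[OF diff(1) p] total_deriv_base_times_jet_coord[OF diff(2) p]
        total_deriv_base_times_jet_coord[OF diff(3) p] D)
  then have EL: "euler_lagrange (lagrangian F) p j = sin (p $ 1) * f (j 0) - sin (p $ 1) * j (E 0 + E 0)
      + cos (p $ 1) * j (E 1) + sin (p $ 1) * j (E 1 + E 1) + inverse (sin (p $ 1)) * j (E 2 + E 2)"
    by (simp only: euler_lagrange_def sum_UNIV_three pd_fibre_lagrangian[OF F_deriv])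
  show ?thesis
    using sin_nonzero[OF p] unfolding EL by (simp add: cot_def field_simps power2_eq_square)
qed

lemma euler_lagrange_solution:
  assumes "solution f U u" "p \<in> U"
  shows "euler_lagrange (lagrangian F) p (jet_of u p) = 0"
  using assms by (simp add: euler_lagrange_lagrangian solution_def jet_of_simps)

text \<open>
  A conserved vector only needs to agree with the Noether current over \<open>U\<close>, because \<open>U\<close> is open and
  smoothness and divergence are local.
\<close>

lemma noether_conservation_lawI:
  assumes X: "noether_symmetry_with U (lagrangian F) X V"
    and A: "\<And>i p j. p \<in> U \<Longrightarrow> A i p j = noether_current (lagrangian F) X V i p j"
  shows "noether_symmetry U (lagrangian F) X \<and> noether_conservation_law f U (lagrangian F) X A"
proof -
  have "diff_fun_on U (A i)" for i
    by (rule diff_fun_on_cong[OF open_U _ diff_fun_on_noether_current[OF diff_fun_on_lagrangian X]])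
      (simp add: A)
  moreover have "Div A p (jet_of u p) = 0" if u: "solution f U u" and p: "p \<in> U" for u p
  proof -
    have "Div A p (jet_of u p) = Div (noether_current (lagrangian F) X V) p (jet_of u p)"
      unfolding Div_def by (intro sum.cong total_deriv_cong[OF p] A refl)
    then show ?thesis
      using Div_noether_current[OF diff_fun_on_lagrangian lagrangian_first_order X p]
        euler_lagrange_solution[OF u p] by simp
  qed
  ultimately have "conservation_law f U A" unfolding conservation_law_def by blast
  then show ?thesis
    unfolding noether_symmetry_def noether_conservation_law_def using X A by blast
qed

section \<open>Symmetries and conserved vectors\<close>

lemma variational_symmetryI:
  assumes "\<And>i. diff_fun_on U (xi X i)" "eta X = (\<lambda>p j. 0)"
    and "\<And>p j. p \<in> U \<Longrightarrow> prolong1 X (lagrangian F) p j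
      + lagrangian F p j * (\<Sum>i\<in>UNIV. total_deriv i (xi X i) p j) = 0"
  shows "noether_symmetry_with U (lagrangian F) X (\<lambda>i p j. 0)"
  using assms by (simp add: noether_symmetry_with_def diff_fun_on_const Div_def total_deriv_const)

lemma variational_noether_current:
  assumes "eta X = (\<lambda>p j. 0)"
  shows "noether_current (lagrangian F) X (\<lambda>i p j. 0) i p j = xi X i p j * lagrangian F p j
     - (xi X 0 p j * j (E 0) + xi X 1 p j * j (E 1) + xi X 2 p j * j (E 2)) * pd (Fibre (E i)) (lagrangian F) p j"
  using assms by (simp add: noether_current_def sum_UNIV_three algebra_simps)

lemma xi_simps:
  "xi S0 i = triple (\<lambda>p j. 1) (\<lambda>p j. 0) (\<lambda>p j. 0) i"
  "xi S1 i = triple (\<lambda>p j. 0) (\<lambda>p j. 0) (\<lambda>p j. 1) i"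
  "xi S2 i = triple (\<lambda>p j. 0) (\<lambda>p j. sin (p $ 2)) (\<lambda>p j. cot (p $ 1) * cos (p $ 2)) i"
  "xi S3 i = triple (\<lambda>p j. 0) (\<lambda>p j. cos (p $ 2)) (\<lambda>p j. - (cot (p $ 1) * sin (p $ 2))) i"
  "xi (S_inf b) i = (\<lambda>p j. 0)"
  by (auto simp: xi_def fun_eq_iff S0_def S1_def S2_def S3_def S_inf_def triple_def)

lemma eta_simps:
  "eta S0 = (\<lambda>p j. 0)" "eta S1 = (\<lambda>p j. 0)" "eta S2 = (\<lambda>p j. 0)" "eta S3 = (\<lambda>p j. 0)"
  "eta (S_inf b) = (\<lambda>p j. b p)"
  by (auto simp: eta_def fun_eq_iff S0_def S1_def S2_def S3_def S_inf_def)

lemma S0_conservation_law: "noether_symmetry U (lagrangian F) S0 \<and>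
    noether_conservation_law f U (lagrangian F) S0 (current_A F)"
proof (rule noether_conservation_lawI)
  show "noether_symmetry_with U (lagrangian F) S0 (\<lambda>i p j. 0)"
    by (rule variational_symmetryI)
      (auto simp: xi_simps eta_simps triple_def diff_fun_on_const prolong1_def eta1_def
        sum_UNIV_three total_deriv_const pd_base_lagrangian)
  fix i p j assume "p \<in> U"
  then show "current_A F i p j = noether_current (lagrangian F) S0 (\<lambda>i p j. 0) i p j"
    using three_cases[of i] sin_nonzero[of p]
    by (elim disjE)
      (simp_all add: variational_noether_current eta_simps xi_simps triple_def current_A_def
        pd_fibre_lagrangian[OF F_deriv] lagrangian_def,
        simp_all add: divide_inverse power2_eq_square)
qed

lemma S1_conservation_law: "noether_symmetry U (lagrangian F) S1 \<and>
    noether_conservation_law f U (lagrangian F) S1 (current_B F)"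
proof (rule noether_conservation_lawI)
  show "noether_symmetry_with U (lagrangian F) S1 (\<lambda>i p j. 0)"
    by (rule variational_symmetryI)
      (auto simp: xi_simps eta_simps triple_def diff_fun_on_const prolong1_def eta1_def
        sum_UNIV_three total_deriv_const pd_base_lagrangian)
  fix i p j assume "p \<in> U"
  then show "current_B F i p j = noether_current (lagrangian F) S1 (\<lambda>i p j. 0) i p j"
    using three_cases[of i] sin_nonzero[of p]
    by (elim disjE)
      (simp_all add: variational_noether_current eta_simps xi_simps triple_def current_B_def
        pd_fibre_lagrangian[OF F_deriv] lagrangian_def,
        simp_all add: divide_inverse power2_eq_square)
qed

lemma cot_has_derivative: "p \<in> U \<Longrightarrow> (cot has_real_derivative - inverse ((sin (p $ 1))\<^sup>2)) (at (p $ 1))"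
  by (rule DERIV_cot) (rule sin_nonzero)

text \<open>
  Infinitesimal rotations about horizontal axes. The \<open>x\<close>-derivative of the Lagrangian, the deformation of the
  first derivatives by the field and the term \<open>L D\<^sub>i \<xi>\<^sup>i = - L cot x g(y)\<close> add up to zero.
\<close>

lemma rotation_symmetry:
  fixes g g' :: "real \<Rightarrow> real" and X
  assumes smooth: "smooth_real g" "smooth_real g'"
    and deriv: "\<And>y. (g has_real_derivative g' y) (at y)" "\<And>y. (g' has_real_derivative - g y) (at y)"
    and xi: "\<And>i. xi X i = triple (\<lambda>p j. 0) (\<lambda>p j. g (p $ 2)) (\<lambda>p j. cot (p $ 1) * g' (p $ 2)) i"
    and eta: "eta X = (\<lambda>p j. 0)"
  shows "noether_symmetry_with U (lagrangian F) X (\<lambda>i p j. 0)"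
proof (rule variational_symmetryI)
  have diff: "diff_fun_on U (\<lambda>p j. cot (p $ 1))" "diff_fun_on U (\<lambda>p j. g (p $ 2))" "diff_fun_on U (\<lambda>p j. g' (p $ 2))"
    using diff_fun_on_cot diff_fun_on_compose[OF smooth(1) diff_fun_on_base_coord]
      diff_fun_on_compose[OF smooth(2) diff_fun_on_base_coord] by blast+
  then show "diff_fun_on U (xi X i)" for i
    by (simp add: xi triple_def diff_fun_on_mult diff_fun_on_const)
  fix p j assume p: "p \<in> U"
  have "total_deriv i (\<lambda>p j. g (p $ 2)) p j = (if i = 2 then g' (p $ 2) else 0)" for i
    by (simp only: total_deriv_base partial_compose_coord[OF deriv(1)])
  moreover have "total_deriv i (\<lambda>p j. cot (p $ 1) * g' (p $ 2)) p j
      = (if i = 1 then - inverse ((sin (p $ 1))\<^sup>2) else 0) * g' (p $ 2)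
        + cot (p $ 1) * (if i = 2 then - g (p $ 2) else 0)" for i
    by (simp only: total_deriv_mult[OF diff(1,3) p])
      (simp only: total_deriv_base partial_compose_coord[OF deriv(2)]
        partial_compose_coord[OF cot_has_derivative[OF p]])
  ultimately have "prolong1 X (lagrangian F) p j
      + lagrangian F p j * (\<Sum>i\<in>UNIV. total_deriv i (xi X i) p j)
    = g (p $ 2) * pd (Base 1) (lagrangian F) p j
      + j (E 2) * inverse ((sin (p $ 1))\<^sup>2) * g' (p $ 2) * pd (Fibre (E 1)) (lagrangian F) p j
      - (j (E 1) * g' (p $ 2) - j (E 2) * (cot (p $ 1) * g (p $ 2))) * pd (Fibre (E 2)) (lagrangian F) p j
      - lagrangian F p j * (cot (p $ 1) * g (p $ 2))"
    by (simp add: prolong1_def eta1_def sum_UNIV_three xi eta triple_def total_deriv_const pd_base_lagrangian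
        left_diff_distrib)
  also have "\<dots> = 0"
    unfolding pd_base_lagrangian(3)[OF sin_nonzero[OF p]] pd_fibre_lagrangian[OF F_deriv] lagrangian_def cot_def
    using sin_nonzero[OF p] by (rule rotation_invariance_algebra)
  finally show "prolong1 X (lagrangian F) p j
      + lagrangian F p j * (\<Sum>i\<in>UNIV. total_deriv i (xi X i) p j) = 0" .
qed (rule eta)

lemma rotation_current:
  fixes g g' :: "real \<Rightarrow> real" and X
  assumes xi: "\<And>i. xi X i = triple (\<lambda>p j. 0) (\<lambda>p j. g (p $ 2)) (\<lambda>p j. cot (p $ 1) * g' (p $ 2)) i"
    and eta: "eta X = (\<lambda>p j. 0)" and p: "p \<in> U"
  shows "noether_current (lagrangian F) X (\<lambda>i p j. 0) 0 p j =
      - (sin (p $ 1) * g (p $ 2) * j (E 0) * j (E 1)) - cos (p $ 1) * g' (p $ 2) * j (E 0) * j (E 2)"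
    and "noether_current (lagrangian F) X (\<lambda>i p j. 0) 1 p j =
      sin (p $ 1) * g (p $ 2) / 2 * (j (E 0))\<^sup>2 + sin (p $ 1) * g (p $ 2) / 2 * (j (E 1))\<^sup>2
      - g (p $ 2) / (2 * sin (p $ 1)) * (j (E 2))\<^sup>2 + cos (p $ 1) * g' (p $ 2) * j (E 1) * j (E 2)
      + sin (p $ 1) * g (p $ 2) * F (j 0)"
    and "noether_current (lagrangian F) X (\<lambda>i p j. 0) 2 p j =
      cos (p $ 1) * g' (p $ 2) / 2 * (j (E 0))\<^sup>2 - cos (p $ 1) * g' (p $ 2) / 2 * (j (E 1))\<^sup>2
      + cos (p $ 1) * g' (p $ 2) / (2 * (sin (p $ 1))\<^sup>2) * (j (E 2))\<^sup>2 + g (p $ 2) / sin (p $ 1) * j (E 1) * j (E 2)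
      + cos (p $ 1) * g' (p $ 2) * F (j 0)"
proof -
  have xi_at: "xi X 0 p j = 0" "xi X 1 p j = g (p $ 2)" "xi X 2 p j = cos (p $ 1) / sin (p $ 1) * g' (p $ 2)"
    by (simp_all add: xi triple_def cot_def)
  note alg = rotation_current_algebra[OF sin_nonzero[OF p]]
  note unfolds = variational_noether_current[OF eta] xi_at pd_fibre_lagrangian[OF F_deriv] lagrangian_def
  show "noether_current (lagrangian F) X (\<lambda>i p j. 0) 0 p j =
      - (sin (p $ 1) * g (p $ 2) * j (E 0) * j (E 1)) - cos (p $ 1) * g' (p $ 2) * j (E 0) * j (E 2)"
    unfolding unfolds by (rule alg)
  show "noether_current (lagrangian F) X (\<lambda>i p j. 0) 1 p j =
      sin (p $ 1) * g (p $ 2) / 2 * (j (E 0))\<^sup>2 + sin (p $ 1) * g (p $ 2) / 2 * (j (E 1))\<^sup>2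
      - g (p $ 2) / (2 * sin (p $ 1)) * (j (E 2))\<^sup>2 + cos (p $ 1) * g' (p $ 2) * j (E 1) * j (E 2)
      + sin (p $ 1) * g (p $ 2) * F (j 0)"
    unfolding unfolds by (rule alg)
  show "noether_current (lagrangian F) X (\<lambda>i p j. 0) 2 p j =
      cos (p $ 1) * g' (p $ 2) / 2 * (j (E 0))\<^sup>2 - cos (p $ 1) * g' (p $ 2) / 2 * (j (E 1))\<^sup>2
      + cos (p $ 1) * g' (p $ 2) / (2 * (sin (p $ 1))\<^sup>2) * (j (E 2))\<^sup>2 + g (p $ 2) / sin (p $ 1) * j (E 1) * j (E 2)
      + cos (p $ 1) * g' (p $ 2) * F (j 0)"
    unfolding unfolds by (rule alg)
qed

lemma S2_conservation_law: "noether_symmetry U (lagrangian F) S2 \<and>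
    noether_conservation_law f U (lagrangian F) S2 (current_C F)"
proof (rule noether_conservation_lawI)
  show "noether_symmetry_with U (lagrangian F) S2 (\<lambda>i p j. 0)"
    by (rule rotation_symmetry[OF smooth_real_sin smooth_real_cos DERIV_sin])
      (auto simp: xi_simps eta_simps intro!: derivative_eq_intros)
  fix i p j assume p: "p \<in> U"
  show "current_C F i p j = noether_current (lagrangian F) S2 (\<lambda>i p j. 0) i p j"
    using three_cases[of i]
    by (elim disjE) (simp_all only: current_C_def triple_def three_distinct zero_neq_one one_neq_zero
        if_True if_False simp_thms rotation_current[where g = sin and g' = cos, OF xi_simps(3) eta_simps(3) p])
qed

lemma S3_conservation_law: "noether_symmetry U (lagrangian F) S3 \<and>
    noether_conservation_law f U (lagrangian F) S3 (current_D F)"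
proof (rule noether_conservation_lawI)
  have smooth: "smooth_real (\<lambda>y. - sin y)" using smooth_real_trig[of "-1" 0] by simp
  have xi: "xi S3 i = triple (\<lambda>p j. 0) (\<lambda>p j. cos (p $ 2)) (\<lambda>p j. cot (p $ 1) * (- sin (p $ 2))) i" for i
    by (simp add: xi_simps)
  show "noether_symmetry_with U (lagrangian F) S3 (\<lambda>i p j. 0)"
    by (rule rotation_symmetry[OF smooth_real_cos smooth _ _ xi eta_simps(4)])
      (auto intro!: derivative_eq_intros)
  fix i p j assume p: "p \<in> U"
  show "current_D F i p j = noether_current (lagrangian F) S3 (\<lambda>i p j. 0) i p j"
    using three_cases[of i]
    by (elim disjE) (simp_all only: current_D_def triple_def three_distinct zero_neq_one one_neq_zero
        if_True if_False simp_thms rotation_current[where g = cos and g' = "\<lambda>y. - sin y", OF xi eta_simps(4) p])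
qed

text \<open>
  Translation by a solution \<open>b\<close> of the linear equation. The term \<open>b f(u) = c b u\<close> of the symmetry condition is
  matched by the terms of \<open>Div V\<close> without derivatives of \<open>u\<close>, by the equation for \<open>b\<close>.
\<close>

lemma S_inf_conservation_law:
  assumes F: "\<forall>v. F v = c * v\<^sup>2 / 2" and b: "solution (\<lambda>v. c * v) U b"
  shows "noether_symmetry U (lagrangian F) (S_inf b) \<and>
    noether_conservation_law f U (lagrangian F) (S_inf b) (current_alpha b)"
proof (rule noether_conservation_lawI)
  define V :: "3 \<Rightarrow> dfun" where "V = triple (\<lambda>p j. (sin (p $ 1) * partial 0 b p) * j 0)
    (\<lambda>p j. (- sin (p $ 1) * partial 1 b p) * j 0) (\<lambda>p j. (- inverse (sin (p $ 1)) * partial 2 b p) * j 0)"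
  have f: "f v = c * v" for v
  proof -
    have "(F has_real_derivative c * v) (at v)"
      unfolding F[rule_format, abs_def] by (auto intro!: derivative_eq_intros)
    then show ?thesis using F_deriv DERIV_unique by blast
  qed
  have smooth_b: "smooth_on U b" using b by (simp add: solution_def)
  note db = diff_fun_on_base[OF smooth_b]
    diff_fun_on_base[OF smooth_on_partial[OF smooth_b]]
  note sin = diff_fun_on_sin
  have diff: "diff_fun_on U (\<lambda>p j. sin (p $ 1) * partial i b p)" "diff_fun_on U (\<lambda>p j. - sin (p $ 1) * partial i b p)"
    "diff_fun_on U (\<lambda>p j. - inverse (sin (p $ 1)) * partial i b p)" for i
    by (intro diff_fun_on_mult sin db)+
  show "noether_symmetry_with U (lagrangian F) (S_inf b) V"
    unfolding noether_symmetry_with_def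
  proof (intro conjI allI ballI)
    show "diff_fun_on U (xi (S_inf b) i)" for i by (simp add: xi_simps diff_fun_on_const)
    show "diff_fun_on U (eta (S_inf b))" by (simp add: eta_simps db)
    show "diff_fun_on U (V i)" for i
      unfolding V_def triple_def
      by (simp only: diff_fun_on_mult diff diff_fun_on_jet_coord split: if_split) simp
    fix p j assume p: "p \<in> U"
    have D: "partial 0 (\<lambda>p. sin (p $ 1) * partial 0 b p) p = sin (p $ 1) * partial 0 (partial 0 b) p"
      "partial 1 (\<lambda>p. - sin (p $ 1) * partial 1 b p) p
        = - cos (p $ 1) * partial 1 b p - sin (p $ 1) * partial 1 (partial 1 b) p"
      "partial 2 (\<lambda>p. - inverse (sin (p $ 1)) * partial 2 b p) p
        = - inverse (sin (p $ 1)) * partial 2 (partial 2 b) p"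
      using total_deriv_mult[OF sin(1) db(2)[of 0] p, where i = 0]
        total_deriv_mult[OF sin(2) db(2)[of 1] p, where i = 1]
        total_deriv_mult[OF sin(3) db(2)[of 2] p, where i = 2]
      unfolding total_deriv_base partial_sin[OF p] by simp_all
    have "partial 0 (partial 0 b) p = partial 1 (partial 1 b) p + cot (p $ 1) * partial 1 b p
        + 1 / (sin (p $ 1))\<^sup>2 * partial 2 (partial 2 b) p + c * b p"
      using b p by (simp add: solution_def)
    \<comment> \<open>the equation for \<open>b\<close> multiplied by \<open>sin x\<close>, in divergence form\<close>
    then have eq: "sin (p $ 1) * partial 0 (partial 0 b) p - cos (p $ 1) * partial 1 b p
        - sin (p $ 1) * partial 1 (partial 1 b) p - inverse (sin (p $ 1)) * partial 2 (partial 2 b) p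
        = sin (p $ 1) * c * b p"
      using sin_nonzero[OF p] by (simp add: cot_def power2_eq_square distrib_left inverse_eq_divide)
    have "Div V p j = (sin (p $ 1) * partial 0 (partial 0 b) p - cos (p $ 1) * partial 1 b p
        - sin (p $ 1) * partial 1 (partial 1 b) p - inverse (sin (p $ 1)) * partial 2 (partial 2 b) p) * j 0
        + sin (p $ 1) * partial 0 b p * j (E 0) - sin (p $ 1) * partial 1 b p * j (E 1)
        - inverse (sin (p $ 1)) * partial 2 b p * j (E 2)"
    proof -
      have "total_deriv 0 (V 0) p j = sin (p $ 1) * partial 0 (partial 0 b) p * j 0
          + sin (p $ 1) * partial 0 b p * j (0 + E 0)"
        "total_deriv 1 (V 1) p j = (- cos (p $ 1) * partial 1 b p - sin (p $ 1) * partial 1 (partial 1 b) p) * j 0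
          + - sin (p $ 1) * partial 1 b p * j (0 + E 1)"
        "total_deriv 2 (V 2) p j = - inverse (sin (p $ 1)) * partial 2 (partial 2 b) p * j 0
          + - inverse (sin (p $ 1)) * partial 2 b p * j (0 + E 2)"
        unfolding V_def triple_def
        by (simp_all only: total_deriv_base_times_jet_coord[OF diff(1) p] total_deriv_base_times_jet_coord[OF diff(2) p]
            total_deriv_base_times_jet_coord[OF diff(3) p] D if_True if_False three_distinct zero_neq_one one_neq_zero simp_thms)
      then show ?thesis
        by (simp add: Div_def sum_UNIV_three left_diff_distrib)
    qed
    then show "prolong1 (S_inf b) (lagrangian F) p j
        + lagrangian F p j * (\<Sum>i\<in>UNIV. total_deriv i (xi (S_inf b) i) p j) = Div V p j"
      unfolding eq by (simp add: prolong1_def eta1_def sum_UNIV_three xi_simps eta_simps total_deriv_const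
          total_deriv_base pd_fibre_lagrangian[OF F_deriv] f)
  qed
  fix i p j assume "p \<in> U"
  then show "current_alpha b i p j = noether_current (lagrangian F) (S_inf b) V i p j"
    using three_cases[of i] sin_nonzero[of p]
    by (auto simp: noether_current_def sum_UNIV_three eta_simps xi_simps triple_def current_alpha_def V_def
        pd_fibre_lagrangian[OF F_deriv] algebra_simps inverse_eq_divide)
qed

end

theorem corollary1:
  fixes f F :: "real \<Rightarrow> real" and U :: "point set"
  assumes "smooth_real f"
    and "\<And>v. (F has_real_derivative f v) (at v)"
    and "open U" and "U \<subseteq> strip"
  shows "(noether_symmetry U (lagrangian F) S0 \<and>
            noether_conservation_law f U (lagrangian F) S0 (current_A F)) \<and>
         (noether_symmetry U (lagrangian F) S1 \<and>
            noether_conservation_law f U (lagrangian F) S1 (current_B F)) \<and>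
         (noether_symmetry U (lagrangian F) S2 \<and>
            noether_conservation_law f U (lagrangian F) S2 (current_C F)) \<and>
         (noether_symmetry U (lagrangian F) S3 \<and>
            noether_conservation_law f U (lagrangian F) S3 (current_D F)) \<and>
         (\<forall>c b. (\<forall>v. F v = c * v\<^sup>2 / 2) \<longrightarrow> solution (\<lambda>v. c * v) U b \<longrightarrow>
            noether_symmetry U (lagrangian F) (S_inf b) \<and>
            noether_conservation_law f U (lagrangian F) (S_inf b) (current_alpha b))"
proof -
  interpret wave_equation U f F
    using assms by unfold_locales
  show ?thesis
    using S0_conservation_law S1_conservation_law S2_conservation_law S3_conservation_law S_inf_conservation_law by blast
qed

end
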